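(* Let $\varphi$ be a non-decreasing function on $(0,\infty)$, let $(\mathcal X,d,\mu)$ be a space of homogeneous type of $\varphi$-growth, let $1\le p<q\le\infty$, and let $\{T_t\}_{t>0}$ be a family of sublinear operators. Then $\{T_t\}_{t>0}$ satisfies $L^p(\mu)-L^q(\mu)$ off-diagonal estimates on balls if and only if it satisfies $L^p(\mu)-L^q(\mu)$ full off-diagonal estimates of type $\varphi$.
   Context: A space of homogeneous type $(\mathcal X,d,\mu)$ is a nonempty set $\mathcal X$ with a distance $d$ and a nonnegative Borel measure $\mu$ such that for some $C_0$, $\mu(B(x,2r))\le C_0\,\mu(B(x,r))<\infty$ for all $x\in\mathcal X$, $r>0$, where $B(x,r)=\{y:d(x,y)<r\}$. It is of $\varphi$-growth if $\mu(B(x,r))\sim\varphi(r)$ uniformly for $x\in\mathcal X$ and $r>0$ (two-sided bounds with constants independent of $x,r$). For a ball $B=B(x_B,r_B)$ write $\lambda B=B(x_B,\lambda r_B)$ and $C_j(B)=2^{j+1}B\setminus 2^jB$ for $j\ge2$. Put $\Upsilon(s)=\max\{s,s^{-1}\}$ for $s>0$; $\chi_E$ is the indicator function of $E$; $d(E,F)=\inf\{d(x,y):x\in E,y\in F\}$. $L^p(\mu)-L^q(\mu)$ full off-diagonal estimates of type $\varphi$: there are $C,c>0$ such that for all closed sets $E,F$, all $f$ and all $t>0$, $$\Big(\int_F|T_t(\chi_Ef)|^qd\mu\Big)^{1/q}\le C\,\varphi(\sqrt t)^{\frac1q-\frac1p}\,e^{-\frac{c\,d^2(E,F)}{t}}\Big(\int_E|f|^pd\mu\Big)^{1/p}.$$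 $L^p(\mu)-L^q(\mu)$ off-diagonal estimates on balls: there exist $\theta_1,\theta_2>0$, $c>0$ and $C>0$ such that for every $t>0$, every ball $B$ with radius $r=r_B$, and all $f$, $$\Big(\tfrac1{\mu(B)}\int_B|T_t(\chi_Bf)|^q d\mu\Big)^{1/q}\le C\,\Upsilon\big(\tfrac r{\sqrt t}\big)^{\theta_2}\Big(\tfrac1{\mu(B)}\int_B|f|^pd\mu\Big)^{1/p},$$ and for all $j\ge2$ $$\Big(\tfrac1{\mu(B)}\int_B|T_t(\chi_{C_j(B)}f)|^q d\mu\Big)^{1/q}\le C\,2^{j\theta_1}\Upsilon\big(\tfrac{2^jr}{\sqrt t}\big)^{\theta_2}e^{-\frac{c4^jr^2}{t}}\Big(\tfrac1{\mu(2^{j+1}B)}\int_{C_j(B)}|f|^pd\mu\Big)^{1/p},$$ $$\Big(\tfrac1{\mu(2^{j+1}B)}\int_{C_j(B)}|T_t(\chi_{B}f)|^q d\mu\Big)^{1/q}\le C\,2^{j\theta_1}\Upsilon\big(\tfrac{2^jr}{\sqrt t}\big)^{\theta_2}e^{-\frac{c4^jr^2}{t}}\Big(\tfrac1{\mu(B)}\int_{B}|f|^pd\mu\Big)^{1/p}.$$ Essential suprema are used when $q=\infty$. The operators are defined on some space of functions stable under truncation by indicators of measurable sets and estimates are for $f$ in that space. Sublinear has its usual meaning: $|T(f+g)|\le|Tf|+|Tg|$ and $|T(cf)|=|c||Tf|$.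
   Formalization: Added hypothesis: for f in the domain with finite L^p norm and each t, |T_t f| ≤ liminf_k |T_t(χ_{B(x0,R_k)} f)| a.e. for some balls with R_k→∞. Without it "balls ⇒ full" fails (discontinuous functional on L^p vanishing on bounded supports); full estimates imply it. *)

theory Defs
  imports "HOL-Probability.Essential_Supremum"
begin

definition doubling_measure :: "'a::metric_space measure \<Rightarrow> bool" where
  "doubling_measure M \<longleftrightarrow> sets M = sets borel \<and>
     (\<exists>C0::real. \<forall>x r. r > 0 \<longrightarrow>
        emeasure M (ball x (2 * r)) \<le> ennreal C0 * emeasure M (ball x r) \<and>
        emeasure M (ball x r) < \<infinity>)"

definition phi_growth :: "'a::metric_space measure \<Rightarrow> (real \<Rightarrow> real) \<Rightarrow> bool" where
  "phi_growth M \<phi> \<longleftrightarrow>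
     (\<exists>c1>0. \<exists>c2>0. \<forall>x r. r > 0 \<longrightarrow>
        c1 * \<phi> r \<le> measure M (ball x r) \<and> measure M (ball x r) \<le> c2 * \<phi> r)"

definition annulus :: "'a::metric_space \<Rightarrow> real \<Rightarrow> nat \<Rightarrow> 'a set" where
  "annulus x r j = ball x (2 ^ (j + 1) * r) - ball x (2 ^ j * r)"

definition Upsilon :: "real \<Rightarrow> real" where
  "Upsilon s = max s (1 / s)"

text \<open>The power \<open>x\<^sup>a\<close> on \<open>[0, \<infinity>]\<close>; only exponents \<open>a > 0\<close> are used.\<close>

definition epow :: "ennreal \<Rightarrow> real \<Rightarrow> ennreal" where
  "epow x a = (if x = \<infinity> then \<infinity> else ennreal (enn2real x powr a))"

text \<open>\<open>1/q\<close> as a real number, with \<open>1/\<infinity> = 0\<close>.\<close>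

definition recip :: "ennreal \<Rightarrow> real" where
  "recip q = enn2real (1 / q)"

text \<open>\<open>Lnorm M q A g\<close> is the \<open>L\<^sup>q\<close> norm of \<open>g\<close> over \<open>A\<close>, with values in \<open>[0, \<infinity>]\<close>.
  \<open>Lavg M q A N g\<close> integrates over \<open>A\<close> but normalises by the measure of a possibly different
  set \<open>N\<close>; the normalisation disappears for \<open>q = \<infinity>\<close>.\<close>

definition Lnorm ::
  "'a measure \<Rightarrow> ennreal \<Rightarrow> 'a set \<Rightarrow> ('a \<Rightarrow> 'k::real_normed_vector) \<Rightarrow> ennreal" where
  "Lnorm M q A g =
     (if q = \<infinity> then esssup M (\<lambda>x. ennreal (norm (g x)) * indicator A x)
      else epow (\<integral>\<^sup>+x\<in>A. ennreal (norm (g x) powr enn2real q) \<partial>M) (recip q))"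

definition Lavg ::
  "'a measure \<Rightarrow> ennreal \<Rightarrow> 'a set \<Rightarrow> 'a set \<Rightarrow> ('a \<Rightarrow> 'k::real_normed_vector) \<Rightarrow> ennreal" where
  "Lavg M q A N g =
     (if q = \<infinity> then esssup M (\<lambda>x. ennreal (norm (g x)) * indicator A x)
      else epow ((\<integral>\<^sup>+x\<in>A. ennreal (norm (g x) powr enn2real q) \<partial>M) / emeasure M N) (recip q))"

definition trunc :: "'a set \<Rightarrow> ('a \<Rightarrow> 'k::real_normed_vector) \<Rightarrow> 'a \<Rightarrow> 'k" where
  "trunc A f = (\<lambda>x. indicator A x *\<^sub>R f x)"

text \<open>The scalar field \<open>'k\<close> is a \<open>real_normed_field\<close>, that is, the reals or the complex numbers.\<close>

definition truncation_stable_space ::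
  "'a measure \<Rightarrow> ('a \<Rightarrow> 'k::{real_normed_field, second_countable_topology}) set \<Rightarrow> bool" where
  "truncation_stable_space M D \<longleftrightarrow>
     D \<subseteq> borel_measurable M \<and> D \<noteq> {} \<and>
     (\<forall>f\<in>D. \<forall>g\<in>D. (\<lambda>x. f x + g x) \<in> D) \<and>
     (\<forall>c. \<forall>f\<in>D. (\<lambda>x. c * f x) \<in> D) \<and>
     (\<forall>A\<in>sets M. \<forall>f\<in>D. trunc A f \<in> D)"

definition sublinear_family ::
  "'a measure \<Rightarrow> ('a \<Rightarrow> 'k::{real_normed_field, second_countable_topology}) set
     \<Rightarrow> (real \<Rightarrow> ('a \<Rightarrow> 'k) \<Rightarrow> 'a \<Rightarrow> 'k) \<Rightarrow> bool" where
  "sublinear_family M D T \<longleftrightarrow>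
     (\<forall>t>0. (\<forall>f\<in>D. T t f \<in> borel_measurable M) \<and>
        (\<forall>f\<in>D. \<forall>g\<in>D. AE x in M.
           norm (T t (\<lambda>y. f y + g y) x) \<le> norm (T t f x) + norm (T t g x)) \<and>
        (\<forall>c. \<forall>f\<in>D. AE x in M. norm (T t (\<lambda>y. c * f y) x) = norm c * norm (T t f x)))"

text \<open>Finite sublinearity does not relate \<open>T\<^sub>t f\<close> to the action of \<open>T\<^sub>t\<close> on functions of
  bounded support, and the estimates on balls only involve the latter: a discontinuous linear
  functional on \<open>L\<^sup>p\<close> that vanishes on functions of bounded support, times a fixed function,
  satisfies them but not the full estimates. The condition below excludes this. It holds
  whenever the functions in \<open>D\<close> have bounded support, whenever \<open>T\<^sub>t f\<close> is the limit in
  measure of \<open>T\<^sub>t\<close> on truncations of \<open>f\<close> to balls of radius tending to \<open>\<infinity>\<close>, and, for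
  \<open>p < \<infinity>\<close>, it is implied by the full off-diagonal estimates.\<close>

definition controlled_by_truncations ::
  "'a::metric_space measure \<Rightarrow> ennreal
     \<Rightarrow> ('a \<Rightarrow> 'k::{real_normed_field, second_countable_topology}) set
     \<Rightarrow> (real \<Rightarrow> ('a \<Rightarrow> 'k) \<Rightarrow> 'a \<Rightarrow> 'k) \<Rightarrow> bool" where
  "controlled_by_truncations M p D T \<longleftrightarrow>
     (\<forall>t>0. \<forall>f\<in>D. Lnorm M p UNIV f < \<infinity> \<longrightarrow>
        (\<exists>x0. \<exists>R::nat \<Rightarrow> real. filterlim R at_top sequentially \<and>
           (AE x in M. ennreal (norm (T t f x))
              \<le> liminf (\<lambda>k. ennreal (norm (T t (trunc (ball x0 (R k)) f) x))))))"

text \<open>\<open>setdist\<close> is the infimum of the distances when both sets are nonempty and \<open>0\<close> otherwise;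
  the value is immaterial if \<open>E\<close> or \<open>F\<close> is empty, as the left-hand side below is then \<open>0\<close>.\<close>

definition full_off_diagonal ::
  "'a::metric_space measure \<Rightarrow> (real \<Rightarrow> real) \<Rightarrow> ennreal \<Rightarrow> ennreal
     \<Rightarrow> ('a \<Rightarrow> 'k::{real_normed_field, second_countable_topology}) set
     \<Rightarrow> (real \<Rightarrow> ('a \<Rightarrow> 'k) \<Rightarrow> 'a \<Rightarrow> 'k) \<Rightarrow> bool" where
  "full_off_diagonal M \<phi> p q D T \<longleftrightarrow>
     (\<exists>C>0. \<exists>c>0. \<forall>E F. closed E \<longrightarrow> closed F \<longrightarrow> (\<forall>f\<in>D. \<forall>t>0.
        Lnorm M q F (T t (trunc E f))
        \<le> ennreal (C * \<phi> (sqrt t) powr (recip q - recip p) * exp (- (c * (setdist E F)\<^sup>2 / t)))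
            * Lnorm M p E f))"

definition off_diagonal_on_balls ::
  "'a::metric_space measure \<Rightarrow> ennreal \<Rightarrow> ennreal
     \<Rightarrow> ('a \<Rightarrow> 'k::{real_normed_field, second_countable_topology}) set
     \<Rightarrow> (real \<Rightarrow> ('a \<Rightarrow> 'k) \<Rightarrow> 'a \<Rightarrow> 'k) \<Rightarrow> bool" where
  "off_diagonal_on_balls M p q D T \<longleftrightarrow>
     (\<exists>\<theta>1>0. \<exists>\<theta>2>0. \<exists>c>0. \<exists>C>0. \<forall>t>0. \<forall>x. \<forall>r>0. \<forall>f\<in>D.
        Lavg M q (ball x r) (ball x r) (T t (trunc (ball x r) f))
          \<le> ennreal (C * Upsilon (r / sqrt t) powr \<theta>2) * Lavg M p (ball x r) (ball x r) f \<and>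
        (\<forall>j\<ge>2.
           Lavg M q (ball x r) (ball x r) (T t (trunc (annulus x r j) f))
             \<le> ennreal (C * 2 powr (real j * \<theta>1) * Upsilon (2 ^ j * r / sqrt t) powr \<theta>2
                          * exp (- (c * 4 ^ j * r\<^sup>2 / t)))
                 * Lavg M p (annulus x r j) (ball x (2 ^ (j + 1) * r)) f \<and>
           Lavg M q (annulus x r j) (ball x (2 ^ (j + 1) * r)) (T t (trunc (ball x r) f))
             \<le> ennreal (C * 2 powr (real j * \<theta>1) * Upsilon (2 ^ j * r / sqrt t) powr \<theta>2
                          * exp (- (c * 4 ^ j * r\<^sup>2 / t)))
                 * Lavg M p (ball x r) (ball x r) f))"

end

theory Submission
  imports Defs
begin

text \<open>
  If the full estimates hold, test them on closed balls and closed annuli; the annulus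
  \<open>C\<^sub>j(B)\<close> lies at distance at least \<open>2\<^sup>j r / 2\<close> from \<open>B\<close>, and
  \<open>\<phi>(\<surd>t)\<close> is compared with \<open>\<mu>(B)\<close> by doubling, which costs powers of
  \<open>\<Upsilon>\<close> and of \<open>2\<^sup>j\<close>.

  Conversely, fix \<open>t\<close>, put \<open>r = \<surd>t\<close> and take a maximal \<open>r\<close>-separated set of
  centres \<open>x\<close> in a bounded part of \<open>F\<close>. On \<open>B(x, r)\<close> split \<open>f\<close> into
  the pieces on \<open>4B\<close> and on the annuli \<open>C\<^sub>j(B)\<close>. Only pieces with
  \<open>d(E, F) \<le> 2\<^sup>j\<^sup>+\<^sup>1 r\<close> occur, so a part of the factor \<open>exp (- c 4\<^sup>j)\<close> pays for
  \<open>exp (- c d\<^sup>2(E, F) / t)\<close> and the rest for the overlap of the balls \<open>2\<^sup>j\<^sup>+\<^sup>1 B\<close>; the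
  embedding of \<open>l\<^sup>p\<close> into \<open>l\<^sup>q\<close> sums the pieces over the centres. Fatou's lemma
  removes the boundedness of the supports.
\<close>

section \<open>Norms on subsets\<close>

lemma enn2real_recip:
  assumes "1 \<le> q" "q \<noteq> (\<infinity>::ennreal)"
  shows "1 \<le> enn2real q" "recip q = 1 / enn2real q"
proof -
  obtain r where r: "q = ennreal r" "r \<ge> 0"
    using assms(2) by (cases q) auto
  with assms(1) have "1 \<le> r" by simp
  with r show "1 \<le> enn2real q" "recip q = 1 / enn2real q"
    by (simp_all add: recip_def divide_ennreal flip: ennreal_1)
qed

lemma recip_top [simp]: "recip top = 0"
  by (simp add: recip_def)

lemma recip_nonneg [simp]: "0 \<le> recip q"
  by (simp add: recip_def)

lemma recip_strict_antimono:
  assumes "1 \<le> p" "p < q"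
  shows "recip q < recip p"
proof -
  have p: "p \<noteq> \<infinity>" using assms(2) by auto
  show ?thesis
  proof (cases "q = \<infinity>")
    case True
    then show ?thesis using enn2real_recip[OF assms(1) p] by simp
  next
    case False
    have "enn2real p < enn2real q"
      using assms p False by (simp add: enn2real_less_iff less_top)
    then show ?thesis
      using enn2real_recip[OF assms(1) p] enn2real_recip[of q] assms False
      by (simp add: frac_less2)
  qed
qed

lemma epow_le_iff:
  assumes "0 < a" "0 \<le> K"
  shows "epow x (1 / a) \<le> ennreal K \<longleftrightarrow> x \<le> ennreal (K powr a)"
proof (cases x)
  case (real y)
  have "y powr (1 / a) \<le> K \<longleftrightarrow> (y powr (1 / a)) powr a \<le> K powr a"
    using assms powr_less_mono2[of a K "y powr (1/a)"] powr_mono2[of a "y powr (1/a)" K]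
    by force
  also have "(y powr (1 / a)) powr a = y"
    using assms real by (simp add: powr_powr)
  finally show ?thesis using real assms by (simp add: epow_def)
next
  case top
  then show ?thesis by (simp add: epow_def top_unique)
qed

text \<open>Against a real bound the outer power can be moved to the right-hand side. The work for
  finite exponents is then done with integrals, where Fatou's lemma and finite sums apply.\<close>

lemma Lnorm_le_iff_finite:
  assumes "1 \<le> q" "q \<noteq> \<infinity>" "0 \<le> K"
  shows "Lnorm M q A g \<le> ennreal K \<longleftrightarrow>
    (\<integral>\<^sup>+x\<in>A. ennreal (norm (g x) powr enn2real q) \<partial>M) \<le> ennreal (K powr enn2real q)"
proof -
  have "0 < enn2real q" using enn2real_recip(1)[OF assms(1,2)] by linarith
  from epow_le_iff[OF this assms(3)] show ?thesis
    using assms by (simp add: Lnorm_def enn2real_recip)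
qed

lemma Lnorm_le_iff_top:
  assumes [measurable]: "A \<in> sets M" "g \<in> borel_measurable M" and "0 \<le> K"
  shows "Lnorm M top A g \<le> ennreal K \<longleftrightarrow> (AE x in M. x \<in> A \<longrightarrow> norm (g x) \<le> K)"
proof -
  let ?h = "\<lambda>x. ennreal (norm (g x)) * indicator A x"
  have [measurable]: "?h \<in> borel_measurable M" by measurable
  have "esssup M ?h \<le> ennreal K \<longleftrightarrow> (AE x in M. ?h x \<le> ennreal K)"
  proof
    assume "esssup M ?h \<le> ennreal K"
    then show "AE x in M. ?h x \<le> ennreal K"
      using esssup_AE[of ?h M] by (auto elim: order_trans)
  qed (auto intro: esssup_I)
  also have "\<dots> \<longleftrightarrow> (AE x in M. x \<in> A \<longrightarrow> norm (g x) \<le> K)"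
    using assms(3) by (intro AE_cong) (auto simp: indicator_def)
  finally show ?thesis by (simp add: Lnorm_def)
qed

lemma epow_mono: "0 \<le> a \<Longrightarrow> x \<le> y \<Longrightarrow> epow x a \<le> epow y a"
  by (auto simp: epow_def top_unique less_top intro!: ennreal_leI powr_mono2 enn2real_mono)

lemma Lnorm_mono_set:
  assumes "A \<subseteq> B" and [measurable]: "A \<in> sets M" "B \<in> sets M" "g \<in> borel_measurable M"
  shows "Lnorm M q A g \<le> Lnorm M q B g"
proof (cases "q = \<infinity>")
  case True
  then show ?thesis
    using assms(1) by (auto simp: Lnorm_def indicator_def intro!: esssup_mono)
next
  case False
  then show ?thesis
    using assms(1)
    by (auto simp: Lnorm_def indicator_def intro!: epow_mono nn_integral_mono)
qed

lemma Lnorm_trunc: "Lnorm M q A (trunc B f) = Lnorm M q (A \<inter> B) f"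
proof -
  have "(\<lambda>x. ennreal (norm (trunc B f x)) * indicator A x) = (\<lambda>x. ennreal (norm (f x)) * indicator (A \<inter> B) x)"
    "(\<lambda>x. ennreal (norm (trunc B f x) powr a) * indicator A x) =
      (\<lambda>x. ennreal (norm (f x) powr a) * indicator (A \<inter> B) x)" for a
    by (auto simp: trunc_def indicator_def)
  then show ?thesis by (simp add: Lnorm_def)
qed

lemma trunc_trunc: "trunc A (trunc B f) = trunc (A \<inter> B) f"
  by (auto simp: trunc_def indicator_def)

lemma Lnorm_empty [simp]: "Lnorm M q {} g = 0"
proof -
  have "esssup M (\<lambda>x. 0::ennreal) \<le> 0" by (intro esssup_I) auto
  then show ?thesis by (simp add: Lnorm_def epow_def)
qed

text \<open>With \<open>recip top = 0\<close> the factor is \<open>m powr 0 = 1\<close>, so averages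
  at \<open>q = \<infinity>\<close> obey the same formula. Positivity of \<open>m\<close> matters
  because \<open>0 powr 0 = 0\<close>.\<close>

lemma Lavg_eq_Lnorm:
  assumes "1 \<le> q" "emeasure M N = ennreal m" "0 < m"
  shows "Lavg M q A N g = ennreal (m powr - recip q) * Lnorm M q A g"
proof (cases "q = \<infinity>")
  case True
  then show ?thesis using assms by (simp add: Lavg_def Lnorm_def)
next
  case False
  note q = enn2real_recip[OF assms(1) False]
  have "epow (x / ennreal m) (recip q) = ennreal (m powr - recip q) * epow x (recip q)" for x
  proof (cases x)
    case (real y)
    then show ?thesis
      using assms(3)
      by (simp add: epow_def divide_ennreal powr_divide powr_minus field_simps flip: ennreal_mult)
  next
    case top
    then show ?thesis using assms(3)
      by (simp add: epow_def ennreal_top_divide ennreal_mult_top)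
  qed
  then show ?thesis using assms False by (simp add: Lavg_def Lnorm_def)
qed

text \<open>Fatou's lemma for norms, over sets that eventually contain each point of
  \<open>F\<close>. At \<open>q = \<infinity>\<close> the bound passes to the limit pointwise; for
  finite \<open>q\<close> Fatou is applied to the q-th powers.\<close>

lemma Lnorm_le_liminf:
  assumes q: "1 \<le> q" and K: "0 \<le> K"
    and [measurable]: "F \<in> sets M" "\<And>k. A k \<in> sets M" "g \<in> borel_measurable M" "\<And>k. h k \<in> borel_measurable M"
    and le: "\<And>k::nat. Lnorm M q (A k) (h k) \<le> ennreal K"
    and ev: "\<And>x. x \<in> F \<Longrightarrow> eventually (\<lambda>k. x \<in> A k) sequentially"
    and lim: "AE x in M. ennreal (norm (g x)) \<le> liminf (\<lambda>k. ennreal (norm (h k x)))"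
  shows "Lnorm M q F g \<le> ennreal K"
proof (cases "q = \<infinity>")
  case True
  have "AE x in M. \<forall>k. x \<in> A k \<longrightarrow> norm (h k x) \<le> K"
    using le K unfolding True by (simp add: Lnorm_le_iff_top AE_all_countable)
  with lim have "AE x in M. x \<in> F \<longrightarrow> norm (g x) \<le> K"
  proof eventually_elim
    case (elim x)
    show ?case
    proof
      assume "x \<in> F"
      have "eventually (\<lambda>k. ennreal (norm (h k x)) \<le> ennreal K) sequentially"
        using ev[OF \<open>x \<in> F\<close>] by eventually_elim (use elim K in auto)
      then have "liminf (\<lambda>k. ennreal (norm (h k x))) \<le> ennreal K"
        by (intro Liminf_le) auto
      with elim(1) have "ennreal (norm (g x)) \<le> ennreal K" by (rule order_trans)
      then show "norm (g x) \<le> K" using K by simp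
    qed
  qed
  then show ?thesis using K by (simp add: True Lnorm_le_iff_top)
next
  case False
  define a where "a = enn2real q"
  have a: "1 \<le> a" using enn2real_recip[OF q False] by (simp add: a_def)
  let ?G = "\<lambda>k x. ennreal (norm (h k x) powr a) * indicator (A k) x"
  have "(\<integral>\<^sup>+x\<in>F. ennreal (norm (g x) powr a) \<partial>M) \<le> (\<integral>\<^sup>+x. liminf (\<lambda>k. ?G k x) \<partial>M)"
  proof (rule nn_integral_mono_AE)
    from lim show "AE x in M. ennreal (norm (g x) powr a) * indicator F x \<le> liminf (\<lambda>k. ?G k x)"
    proof eventually_elim
      case (elim x)
      show ?case
      proof (cases "x \<in> F")
        case True
        \<comment> \<open>The power \<open>a\<close> is moved through the lower limit by testing
          with every smaller \<open>y\<close>: the root \<open>z powr (1/a)\<close> lies strictly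
          below \<open>norm (g x)\<close>, hence eventually below
          \<open>norm (h k x)\<close>.\<close>
        show ?thesis unfolding le_Liminf_iff
        proof (intro allI impI)
          fix y assume y: "y < ennreal (norm (g x) powr a) * indicator F x"
          then obtain z where z: "y = ennreal z" "0 \<le> z" by (cases y) auto
          have zg: "z < norm (g x) powr a" using y z True by (simp add: ennreal_less_iff)
          have "z powr (1/a) < (norm (g x) powr a) powr (1/a)"
            using zg z a by (intro powr_less_mono2) auto
          then have "ennreal (z powr (1/a)) < ennreal (norm (g x))"
            using a by (simp add: powr_powr ennreal_less_iff)
          then have "eventually (\<lambda>k. ennreal (z powr (1/a)) < ennreal (norm (h k x))) sequentially"
            using elim unfolding le_Liminf_iff by blast
          with ev[OF True] show "eventually (\<lambda>k. y < ?G k x) sequentially"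
          proof eventually_elim
            case (elim k)
            then have "z powr (1/a) < norm (h k x)" by (simp add: ennreal_less_iff)
            then have "(z powr (1/a)) powr a < norm (h k x) powr a"
              using a by (intro powr_less_mono2) auto
            then show ?case using elim z a by (simp add: powr_powr ennreal_less_iff)
          qed
        qed
      qed simp
    qed
  qed
  also have "\<dots> \<le> liminf (\<lambda>k. \<integral>\<^sup>+x. ?G k x \<partial>M)"
    by (intro nn_integral_liminf) measurable
  also have "\<dots> \<le> ennreal (K powr a)"
    using le q False K by (intro Liminf_le always_eventually allI) (auto simp: Lnorm_le_iff_finite a_def)
  finally show ?thesis using q False K by (simp add: Lnorm_le_iff_finite a_def)
qed

section \<open>Spaces of uniform volume growth\<close>

lemma Upsilon_ge_1: "0 < s \<Longrightarrow> 1 \<le> Upsilon s"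
  by (cases "s \<le> 1") (auto simp: Upsilon_def le_max_iff_disj)

lemma Upsilon_ge: "s \<le> Upsilon s"
  by (simp add: Upsilon_def)

text \<open>Write \<open>v powr - a\<close> as \<open>v powr (b - a) * v powr - b\<close> and bound
  the first factor by the hypothesis; the powers of \<open>w\<close> then cancel. In use
  \<open>v\<close> is the volume of a ball, \<open>w = \<phi> (sqrt t)\<close>,
  \<open>a = 1/q\<close> and \<open>b = 1/p\<close>.\<close>

lemma powr_volume_factor:
  fixes a b :: real
  assumes "0 < v" "v \<le> A * Y powr k * w" "0 < A" "0 < Y" "0 < w" "a \<le> b"
  shows "v powr - a * w powr (a - b) \<le> A powr (b - a) * Y powr (k * (b - a)) * v powr - b"
proof -
  have "v powr - a = v powr (b - a) * v powr - b"
    by (simp flip: powr_add)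
  also have "v powr (b - a) \<le> (A * Y powr k * w) powr (b - a)"
    using assms by (intro powr_mono2) auto
  also have "\<dots> = A powr (b - a) * Y powr (k * (b - a)) * w powr (b - a)"
    using assms by (simp add: powr_mult powr_powr)
  finally have "v powr - a * w powr (a - b) \<le>
      A powr (b - a) * Y powr (k * (b - a)) * w powr (b - a) * v powr - b * w powr (a - b)"
    by (simp add: mult_right_mono)
  also have "\<dots> = A powr (b - a) * Y powr (k * (b - a)) * v powr - b * (w powr (b - a) * w powr (a - b))"
    by (simp only: ac_simps)
  also have "w powr (b - a) * w powr (a - b) = 1"
    using assms by (simp flip: powr_add)
  finally show ?thesis by simp
qed

text \<open>The doubling constant is written \<open>2 powr \<kappa>\<close>, so that
  \<open>n\<close> doublings cost \<open>2 powr (\<kappa> * n)\<close>. Positivity of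
  \<open>\<phi>\<close> gives every ball of positive radius positive measure; the opposite case is
  settled in the final proof.\<close>

locale growth_space =
  fixes M :: "'a::metric_space measure" and \<phi> :: "real \<Rightarrow> real" and \<kappa> c1 c2 :: real
  assumes sets_M: "sets M = sets borel"
    and finite_ball: "emeasure M (ball x r) < \<infinity>"
    and doubling: "r > 0 \<Longrightarrow> measure M (ball x (2 * r)) \<le> 2 powr \<kappa> * measure M (ball x r)"
    and \<kappa>_pos: "0 < \<kappa>" and c1_pos: "0 < c1" and c2_pos: "0 < c2"
    and \<phi>_pos: "r > 0 \<Longrightarrow> 0 < \<phi> r"
    and growth_lower: "r > 0 \<Longrightarrow> c1 * \<phi> r \<le> measure M (ball x r)"
    and growth_upper: "r > 0 \<Longrightarrow> measure M (ball x r) \<le> c2 * \<phi> r"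
begin

abbreviation vol :: "'a \<Rightarrow> real \<Rightarrow> real" where
  "vol x r \<equiv> measure M (ball x r)"

lemma ball_in_sets [measurable, simp]: "ball x r \<in> sets M"
  by (simp add: sets_M)

lemma closed_in_sets: "closed A \<Longrightarrow> A \<in> sets M"
  by (simp add: sets_M)

lemma annulus_in_sets [measurable, simp]: "annulus x r j \<in> sets M"
  by (simp add: annulus_def)

lemma vol_pos: "0 < r \<Longrightarrow> 0 < vol x r"
  using growth_lower[of r x] \<phi>_pos[of r] c1_pos by (meson less_le_trans mult_pos_pos)

lemma emeasure_ball: "emeasure M (ball x r) = ennreal (vol x r)"
  using finite_ball[of x r] by (intro emeasure_eq_ennreal_measure) auto

lemma vol_mono_set: "A \<subseteq> ball x r \<Longrightarrow> A \<in> sets M \<Longrightarrow> measure M A \<le> vol x r"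
  using finite_ball[of x r] by (intro measure_mono_fmeasurable) (auto simp: fmeasurable_def)

lemma vol_mono: "r \<le> s \<Longrightarrow> vol x r \<le> vol x s"
  by (intro vol_mono_set) auto

lemma vol_pow2: "0 < r \<Longrightarrow> vol x (2 ^ n * r) \<le> 2 powr (\<kappa> * n) * vol x r"
proof (induction n)
  case (Suc n)
  have "vol x (2 ^ Suc n * r) = vol x (2 * (2 ^ n * r))" by (simp add: ac_simps)
  also have "\<dots> \<le> 2 powr \<kappa> * vol x (2 ^ n * r)"
    using Suc by (intro doubling) simp
  also have "\<dots> \<le> 2 powr \<kappa> * (2 powr (\<kappa> * n) * vol x r)"
    using Suc by (intro mult_left_mono) auto
  also have "\<dots> = 2 powr (\<kappa> * Suc n) * vol x r"
    by (simp add: algebra_simps powr_add)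
  finally show ?case .
qed simp

text \<open>With \<open>Y = Upsilon (s / r)\<close>, the ball of radius \<open>s\<close> lies in the
  one of radius \<open>2 ^ n * r\<close> for \<open>n\<close> the ceiling of \<open>log 2 Y\<close>;
  rounding up costs one factor \<open>2 powr \<kappa>\<close>. Since \<open>Y \<ge> 1\<close>, this
  also covers \<open>s < r\<close>.\<close>

lemma vol_le_Upsilon:
  assumes "0 < r" "0 < s"
  shows "vol x s \<le> 2 powr \<kappa> * c2 * Upsilon (s / r) powr \<kappa> * \<phi> r"
proof -
  define Y where "Y = Upsilon (s / r)"
  define n where "n = nat \<lceil>log 2 Y\<rceil>"
  have Y: "1 \<le> Y" "s / r \<le> Y"
    using assms Upsilon_ge_1[of "s / r"] Upsilon_ge[of "s / r"] by (auto simp: Y_def)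
  have n: "log 2 Y \<le> n" "n < log 2 Y + 1"
    using Y(1) by (auto simp: n_def) linarith+
  have "s \<le> Y * r" using Y assms by (simp add: field_simps)
  also have "Y = 2 powr (log 2 Y)" using Y by simp
  also have "\<dots> \<le> 2 powr n" using n by (intro powr_mono) auto
  also have "\<dots> = 2 ^ n" by (simp add: powr_realpow)
  finally have "vol x s \<le> vol x (2 ^ n * r)" using assms by (intro vol_mono) auto
  also have "\<dots> \<le> 2 powr (\<kappa> * n) * vol x r" by (rule vol_pow2) fact
  also have "\<dots> \<le> 2 powr (\<kappa> * (log 2 Y + 1)) * (c2 * \<phi> r)"
    using n \<kappa>_pos growth_upper[OF assms(1), of x] by (intro mult_mono powr_mono) auto
  also have "2 powr (\<kappa> * (log 2 Y + 1)) = 2 powr \<kappa> * Y powr \<kappa>"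
    using Y by (simp add: powr_add distrib_left mult.commute[of \<kappa> "log 2 Y"] flip: powr_powr)
  finally show ?thesis by (simp add: Y_def ac_simps)
qed

end

section \<open>From closed sets to balls\<close>

text \<open>Inserts the normalising factors \<open>u\<close> and \<open>v\<close> of the averages
  into an estimate between plain norms, leaving only a comparison of real constants.\<close>

lemma scaled_ennreal_le:
  assumes "x \<le> ennreal a * y" "u * a \<le> b * v" "0 \<le> a" "0 \<le> b" "0 \<le> u" "0 \<le> v"
  shows "ennreal u * x \<le> ennreal b * (ennreal v * y)"
proof -
  have "ennreal u * x \<le> ennreal u * (ennreal a * y)" using assms by (intro mult_left_mono) auto
  also have "\<dots> = ennreal (u * a) * y" using assms by (simp add: ennreal_mult mult.assoc)
  also have "\<dots> \<le> ennreal (b * v) * y" using assms by (intro mult_right_mono ennreal_leI) auto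
  finally show ?thesis using assms by (simp add: ennreal_mult mult.assoc)
qed

locale operator_family = growth_space M \<phi> \<kappa> c1 c2
  for M :: "'a::metric_space measure" and \<phi> \<kappa> c1 c2 +
  fixes p q :: ennreal
    and D :: "('a \<Rightarrow> 'k::{real_normed_field, second_countable_topology}) set"
    and T :: "real \<Rightarrow> ('a \<Rightarrow> 'k) \<Rightarrow> 'a \<Rightarrow> 'k"
  assumes p_ge_1: "1 \<le> p" and p_less_q: "p < q"
    and stable: "truncation_stable_space M D"
    and sublinear: "sublinear_family M D T"
begin

lemma D_measurable: "f \<in> D \<Longrightarrow> f \<in> borel_measurable M"
  using stable by (auto simp: truncation_stable_space_def)

lemma trunc_in_D: "f \<in> D \<Longrightarrow> A \<in> sets M \<Longrightarrow> trunc A f \<in> D"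
  using stable by (auto simp: truncation_stable_space_def)

lemma T_measurable: "0 < t \<Longrightarrow> f \<in> D \<Longrightarrow> T t f \<in> borel_measurable M"
  using sublinear by (auto simp: sublinear_family_def)

lemma q_ge_1: "1 \<le> q"
  using p_ge_1 p_less_q by (meson less_imp_le order_trans)

lemma p_finite: "p \<noteq> \<infinity>"
  using p_less_q by auto

lemma recip_less: "recip q < recip p"
  using recip_strict_antimono p_ge_1 p_less_q .

lemma Lavg_q_ball: "0 < r \<Longrightarrow> Lavg M q A (ball x r) g = ennreal (vol x r powr - recip q) * Lnorm M q A g"
  by (intro Lavg_eq_Lnorm q_ge_1 emeasure_ball vol_pos)

lemma Lavg_p_ball: "0 < r \<Longrightarrow> Lavg M p A (ball x r) g = ennreal (vol x r powr - recip p) * Lnorm M p A g"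
  by (intro Lavg_eq_Lnorm p_ge_1 emeasure_ball vol_pos)

lemma full_imp_balls:
  assumes "full_off_diagonal M \<phi> p q D T"
  shows "off_diagonal_on_balls M p q D T"
proof -
  obtain C c where Cc: "0 < C" "0 < c"
    and full0: "\<forall>E F. closed E \<longrightarrow> closed F \<longrightarrow> (\<forall>f\<in>D. \<forall>t>0. Lnorm M q F (T t (trunc E f))
        \<le> ennreal (C * \<phi> (sqrt t) powr (recip q - recip p) * exp (- (c * (setdist E F)\<^sup>2 / t)))
            * Lnorm M p E f)"
    using assms unfolding full_off_diagonal_def by (elim exE conjE) (rule that, assumption+)
  note full = full0[rule_format]
  \<comment> \<open>Open balls and annuli need not be closed, so the hypothesis is used on closed
    supersets \<open>E\<close> of \<open>B\<close> and \<open>F\<close> of \<open>A\<close>;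
    truncating to \<open>E\<close> does not change \<open>trunc B f\<close>.\<close>
  have main: "Lnorm M q A (T t (trunc B f)) \<le>
      ennreal (C * \<phi> (sqrt t) powr (recip q - recip p) * exp (- (c * d\<^sup>2 / t))) * Lnorm M p B f"
    if "A \<subseteq> F" "B \<subseteq> E" "closed E" "closed F" "A \<in> sets M" "B \<in> sets M" "f \<in> D" "0 < t"
      "0 \<le> d" "\<And>x y. x \<in> E \<Longrightarrow> y \<in> F \<Longrightarrow> d \<le> dist x y" for A B E F f t d
  \<comment> \<open>Here \<open>setdist\<close> is \<open>0\<close> by convention, so
    \<open>d \<le> setdist E F\<close> may fail. For \<open>E = {}\<close> the hypothesis has norm
    \<open>0\<close> on its right and forces the left side to vanish.\<close>
  proof (cases "E = {} \<or> F = {}")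
    case True
    show ?thesis
    proof (cases "F = {}")
      case True
      with that show ?thesis by simp
    next
      case False
      with True that have "E = {}" "B = {}" by auto
      with full[of "{}" UNIV f t] that have "Lnorm M q UNIV (T t (trunc B f)) = 0" by simp
      moreover have "Lnorm M q A (T t (trunc B f)) \<le> Lnorm M q UNIV (T t (trunc B f))"
        using that by (intro Lnorm_mono_set T_measurable trunc_in_D) (auto simp: sets_M)
      ultimately show ?thesis by simp
    qed
  next
    case False
    then have d: "d \<le> setdist E F" using that by (intro le_setdistI) auto
    have g: "trunc B f \<in> D" using that by (intro trunc_in_D)
    have "trunc E (trunc B f) = trunc B f" using that by (simp add: trunc_trunc Int_absorb1)
    then have "Lnorm M q A (T t (trunc B f)) \<le> Lnorm M q F (T t (trunc E (trunc B f)))"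
      using that g by (auto intro!: Lnorm_mono_set T_measurable closed_in_sets)
    also have "\<dots> \<le> ennreal (C * \<phi> (sqrt t) powr (recip q - recip p) * exp (- (c * (setdist E F)\<^sup>2 / t)))
            * Lnorm M p E (trunc B f)"
      using that g by (intro full)
    also have "\<dots> \<le> ennreal (C * \<phi> (sqrt t) powr (recip q - recip p) * exp (- (c * d\<^sup>2 / t)))
            * Lnorm M p E (trunc B f)"
      using Cc d that
      by (intro mult_right_mono ennreal_leI mult_left_mono)
         (auto intro!: divide_right_mono mult_left_mono power_mono)
    also have "Lnorm M p E (trunc B f) = Lnorm M p B f"
      using that by (simp add: Lnorm_trunc Int_absorb1)
    finally show ?thesis .
  qed
  define \<alpha> where "\<alpha> = recip p - recip q"
  \<comment> \<open>The constant that \<open>powr_volume_factor\<close> produces for volumes at most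
    \<open>4 powr \<kappa> * c2 * Y powr \<kappa> * \<phi> (sqrt t)\<close>.\<close>
  define W where "W = (4 powr \<kappa> * c2) powr \<alpha>"
  have \<alpha>: "0 < \<alpha>" using recip_less by (simp add: \<alpha>_def)
  have W: "0 < W" using c2_pos by (simp add: W_def)
  have four: "(4::real) powr \<kappa> = 2 powr \<kappa> * 2 powr \<kappa>"
    by (simp flip: powr_mult)
  have two_le: "(2::real) powr \<kappa> \<le> 4 powr \<kappa>"
    using \<kappa>_pos by (intro powr_mono2) auto
  have factor: "v powr - recip q * \<phi> (sqrt t) powr (recip q - recip p) \<le>
      W * Y powr (\<kappa> * \<alpha>) * v powr - recip p"
    if "0 < v" "v \<le> 4 powr \<kappa> * c2 * Y powr \<kappa> * \<phi> (sqrt t)" "0 < Y" "0 < t" for v Y t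
    unfolding W_def \<alpha>_def
    using that recip_less \<phi>_pos c2_pos by (intro powr_volume_factor) auto
  have bound1: "Lavg M q (ball x r) (ball x r) (T t (trunc (ball x r) f))
      \<le> ennreal (C * W * 2 powr \<kappa> * Upsilon (r / sqrt t) powr (\<kappa> * \<alpha>)) * Lavg M p (ball x r) (ball x r) f"
    if "0 < t" "0 < r" "f \<in> D" for t x r f
  proof -
    let ?Y = "Upsilon (r / sqrt t)"
    have Y: "0 < ?Y" using Upsilon_ge_1[of "r / sqrt t"] that by simp
    have "vol x r \<le> 2 powr \<kappa> * c2 * ?Y powr \<kappa> * \<phi> (sqrt t)"
      using that by (intro vol_le_Upsilon) auto
    also have "\<dots> \<le> 4 powr \<kappa> * c2 * ?Y powr \<kappa> * \<phi> (sqrt t)"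
      using two_le c2_pos \<phi>_pos[of "sqrt t"] that by (intro mult_right_mono) auto
    finally have "vol x r powr - recip q * \<phi> (sqrt t) powr (recip q - recip p) \<le>
      W * ?Y powr (\<kappa> * \<alpha>) * vol x r powr - recip p"
      using that Y by (intro factor vol_pos)
    \<comment> \<open>The spare factor \<open>2 powr \<kappa>\<close> lets this bound share one
      constant with the annulus bounds.\<close>
    also have "\<dots> \<le> W * 2 powr \<kappa> * ?Y powr (\<kappa> * \<alpha>) * vol x r powr - recip p"
      using W \<kappa>_pos ge_one_powr_ge_zero[of 2 \<kappa>] by (intro mult_right_mono) auto
    finally have *: "vol x r powr - recip q * \<phi> (sqrt t) powr (recip q - recip p) \<le> \<dots>" .
    have "Lnorm M q (ball x r) (T t (trunc (ball x r) f)) \<le>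
        ennreal (C * \<phi> (sqrt t) powr (recip q - recip p) * exp (- (c * 0\<^sup>2 / t))) * Lnorm M p (ball x r) f"
      using that by (intro main[where F="cball x r" and E="cball x r"]) auto
    then show ?thesis
      using that Cc W mult_left_mono[OF *, of C]
      unfolding Lavg_q_ball[OF that(2)] Lavg_p_ball[OF that(2)]
      by (intro scaled_ennreal_le[where a="C * \<phi> (sqrt t) powr (recip q - recip p)"]) (auto simp: ac_simps)
  qed
  \<comment> \<open>Both annulus estimates at once: \<open>s\<close> is the radius of the
    normalising ball on the left, \<open>u\<close> the one on the right. The rate
    \<open>c / 4\<close> comes from the distance \<open>2 ^ j * r / 2\<close> below.\<close>
  have bound: "Lavg M q A (ball x s) (T t (trunc B f))
      \<le> ennreal (C * W * 2 powr \<kappa> * 2 powr (real j * \<kappa>) * Upsilon (2 ^ j * r / sqrt t) powr (\<kappa> * \<alpha>)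
           * exp (- (c / 4 * 4 ^ j * r\<^sup>2 / t))) * Lavg M p B (ball x u) f"
    if "0 < t" "0 < r" "f \<in> D" "2 \<le> j"
      and AB: "A = ball x r \<and> B = annulus x r j \<and> s = r \<and> u = 2 ^ (j + 1) * r \<or>
          A = annulus x r j \<and> B = ball x r \<and> s = 2 ^ (j + 1) * r \<and> u = r"
    for t r f x A B s u and j :: nat
  proof -
    let ?Y = "Upsilon (2 ^ j * r / sqrt t)"
    let ?R = "2 ^ (j + 1) * r"
    let ?ann = "cball x ?R - ball x (2 ^ j * r)"
    have Y: "0 < ?Y" using Upsilon_ge_1[of "2 ^ j * r / sqrt t"] that by simp
    have su: "0 < s" "0 < u" using AB \<open>0 < r\<close> by auto
    have "vol x ?R \<le> 2 powr \<kappa> * vol x (2 ^ j * r)"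
      using doubling[of "2 ^ j * r" x] that by (simp add: mult.assoc)
    also have "\<dots> \<le> 2 powr \<kappa> * (2 powr \<kappa> * c2 * ?Y powr \<kappa> * \<phi> (sqrt t))"
      using that by (intro mult_left_mono vol_le_Upsilon) auto
    finally have R_le: "vol x ?R \<le> 4 powr \<kappa> * c2 * ?Y powr \<kappa> * \<phi> (sqrt t)"
      by (simp add: four ac_simps)
    have r_le_R: "vol x r \<le> vol x ?R"
      using that two_realpow_ge_one[of "Suc j"] by (intro vol_mono) (simp add: mult_le_cancel_right1)
    have u_le: "vol x u \<le> 4 powr \<kappa> * c2 * ?Y powr \<kappa> * \<phi> (sqrt t)"
      using R_le r_le_R AB by auto
    \<comment> \<open>Exchanging the normalisation at radius \<open>s\<close> for the one at
      \<open>u\<close> costs at most \<open>j + 1\<close> doublings. This is the source of the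
      factor \<open>2 powr (real j * \<kappa>)\<close>, that is, of the choice
      \<open>\<theta>1 = \<kappa>\<close>.\<close>
    have "vol x u \<le> 2 powr (\<kappa> * real (j + 1)) * vol x s"
    proof (cases "u = ?R \<and> s = r")
      case True
      with vol_pow2[OF that(2), of x "j + 1"] show ?thesis by simp
    next
      case False
      with AB have [simp]: "u = r" "s = ?R" by auto
      have "vol x r \<le> 1 * vol x ?R" using r_le_R by simp
      also have "\<dots> \<le> 2 powr (\<kappa> * real (j + 1)) * vol x ?R"
        using \<kappa>_pos by (intro mult_right_mono ge_one_powr_ge_zero) auto
      finally show ?thesis by simp
    qed
    then have "vol x u / 2 powr (\<kappa> * real (j + 1)) \<le> vol x s" by (simp add: field_simps)
    then have "vol x s powr - recip q \<le> (vol x u / 2 powr (\<kappa> * real (j + 1))) powr - recip q"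
      using vol_pos[OF su(2), of x] by (intro powr_mono2') auto
    also have "\<dots> = 2 powr (\<kappa> * real (j + 1) * recip q) * vol x u powr - recip q"
      by (simp add: powr_divide powr_powr powr_minus field_simps)
    also have "\<dots> \<le> 2 powr (\<kappa> * real (j + 1)) * vol x u powr - recip q"
    proof (intro mult_right_mono powr_mono)
      have "recip p \<le> 1" using enn2real_recip[OF p_ge_1 p_finite] by simp
      then have "recip q \<le> 1" using recip_less by simp
      then show "\<kappa> * real (j + 1) * recip q \<le> \<kappa> * real (j + 1)"
        using \<kappa>_pos by (intro mult_left_le) auto
    qed auto
    finally have "vol x s powr - recip q * \<phi> (sqrt t) powr (recip q - recip p) \<le>
      2 powr (\<kappa> * real (j + 1)) * (vol x u powr - recip q * \<phi> (sqrt t) powr (recip q - recip p))"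
      by (simp add: mult_right_mono flip: mult.assoc)
    also have "\<dots> \<le> 2 powr (\<kappa> * real (j + 1)) * (W * ?Y powr (\<kappa> * \<alpha>) * vol x u powr - recip p)"
      using that Y u_le vol_pos[OF su(2)] by (intro mult_left_mono factor) auto
    finally have *: "vol x s powr - recip q * \<phi> (sqrt t) powr (recip q - recip p) \<le>
        W * 2 powr \<kappa> * 2 powr (real j * \<kappa>) * ?Y powr (\<kappa> * \<alpha>) * vol x u powr - recip p"
      by (simp add: powr_add distrib_left ac_simps)
    \<comment> \<open>\<open>?ann\<close> is a closed superset of the annulus. The gap
      \<open>2 ^ j * r - r\<close> is at least half of \<open>2 ^ j * r\<close> because
      \<open>2 ^ j \<ge> 2\<close>.\<close>
    have far: "2 ^ j * r / 2 \<le> dist y z" if "y \<in> ?ann" "z \<in> cball x r" for y z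
    proof -
      have "2 ^ j * r - r \<le> dist y z"
        using that dist_triangle[of x y z] by (auto simp: dist_commute)
      moreover have "(2::real) ^ 1 \<le> 2 ^ j" using \<open>2 \<le> j\<close> by (intro power_increasing) auto
      then have "2 * r \<le> 2 ^ j * r" using \<open>0 < r\<close> by simp
      ultimately show ?thesis by simp
    qed
    have far': "2 ^ j * r / 2 \<le> dist z y" if "y \<in> ?ann" "z \<in> cball x r" for y z
      using far[OF that] by (simp add: dist_commute)
    have "Lnorm M q A (T t (trunc B f)) \<le>
        ennreal (C * \<phi> (sqrt t) powr (recip q - recip p) * exp (- (c * (2 ^ j * r / 2)\<^sup>2 / t))) * Lnorm M p B f"
      using AB
    proof
      assume AB: "A = ball x r \<and> B = annulus x r j \<and> s = r \<and> u = ?R"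
      show ?thesis
        using AB that far
        by (intro main[where F="cball x r" and E="?ann"]) (auto simp: annulus_def closed_Diff)
    next
      assume AB: "A = annulus x r j \<and> B = ball x r \<and> s = ?R \<and> u = r"
      show ?thesis
        using AB that far'
        by (intro main[where E="cball x r" and F="?ann"]) (auto simp: annulus_def closed_Diff)
    qed
    moreover have "(4::real) ^ j = 2 ^ j * 2 ^ j"
      by (simp flip: power_mult_distrib)
    then have "c * (2 ^ j * r / 2)\<^sup>2 / t = c / 4 * 4 ^ j * r\<^sup>2 / t"
      by (simp add: power2_eq_square)
    ultimately show ?thesis
      using that Cc W mult_left_mono[OF *, of "C * exp (- (c / 4 * 4 ^ j * r\<^sup>2 / t))"]
      unfolding Lavg_q_ball[OF su(1)] Lavg_p_ball[OF su(2)]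
      by (intro scaled_ennreal_le[where a="C * \<phi> (sqrt t) powr (recip q - recip p) * exp (- (c / 4 * 4 ^ j * r\<^sup>2 / t))"])
         (auto simp: ac_simps)
  qed
  have pos: "0 < \<kappa> * \<alpha>" "0 < c / 4" "0 < C * W * 2 powr \<kappa>"
    using \<kappa>_pos \<alpha> Cc W by auto
  show ?thesis
    unfolding off_diagonal_on_balls_def
  proof (rule exI[of _ \<kappa>], rule conjI[OF \<kappa>_pos], rule exI[of _ "\<kappa> * \<alpha>"], rule conjI[OF pos(1)],
      rule exI[of _ "c / 4"], rule conjI[OF pos(2)], rule exI[of _ "C * W * 2 powr \<kappa>"],
      rule conjI[OF pos(3)], intro conjI allI impI ballI)
    fix t r :: real and x f assume "0 < t" "0 < r" "f \<in> D"
    then show "Lavg M q (ball x r) (ball x r) (T t (trunc (ball x r) f))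
      \<le> ennreal (C * W * 2 powr \<kappa> * Upsilon (r / sqrt t) powr (\<kappa> * \<alpha>)) * Lavg M p (ball x r) (ball x r) f"
      by (rule bound1)
  next
    fix t r :: real and x f and j :: nat assume "0 < t" "0 < r" "f \<in> D" "2 \<le> j"
    note bound = bound[OF this]
    show "Lavg M q (ball x r) (ball x r) (T t (trunc (annulus x r j) f))
        \<le> ennreal (C * W * 2 powr \<kappa> * 2 powr (real j * \<kappa>) * Upsilon (2 ^ j * r / sqrt t) powr (\<kappa> * \<alpha>)
           * exp (- (c / 4 * 4 ^ j * r\<^sup>2 / t))) * Lavg M p (annulus x r j) (ball x (2 ^ (j + 1) * r)) f"
      by (rule bound) (intro disjI1 conjI refl)
    show "Lavg M q (annulus x r j) (ball x (2 ^ (j + 1) * r)) (T t (trunc (ball x r) f))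
        \<le> ennreal (C * W * 2 powr \<kappa> * 2 powr (real j * \<kappa>) * Upsilon (2 ^ j * r / sqrt t) powr (\<kappa> * \<alpha>)
           * exp (- (c / 4 * 4 ^ j * r\<^sup>2 / t))) * Lavg M p (ball x r) (ball x r) f"
      by (rule bound) (intro disjI2 conjI refl)
  qed
qed

end

section \<open>From balls to closed sets\<close>

lemma sum_half_powers_le: "(\<Sum>j=1..J. (1/2::real) ^ j) \<le> 1"
proof -
  have "(\<Sum>j=1..J. (1/2::real) ^ j) = 1 - (1/2) ^ J"
    by (induction J) auto
  then show ?thesis by simp
qed

text \<open>A crude substitute for Minkowski's inequality: the sum is at most the largest \<open>2\<^sup>j u\<^sub>j\<close>.\<close>

lemma powr_sum_le_sum_powr:
  fixes u :: "nat \<Rightarrow> real"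
  assumes u: "\<And>j. 0 \<le> u j" and a: "0 < a"
  shows "(\<Sum>j=1..J. u j) powr a \<le> (\<Sum>j=1..J. (2 ^ j * u j) powr a)"
proof (cases "J = 0")
  case False
  define m where "m = Max ((\<lambda>j. 2 ^ j * u j) ` {1..J})"
  have "m \<in> (\<lambda>j. 2 ^ j * u j) ` {1..J}"
    unfolding m_def using False by (intro Max_in) auto
  then obtain i where i: "i \<in> {1..J}" "m = 2 ^ i * u i" by blast
  have m0: "0 \<le> m" using i u by simp
  have "u j \<le> m * (1/2) ^ j" if "j \<in> {1..J}" for j
  proof -
    have "2 ^ j * u j \<le> m" unfolding m_def using that by (intro Max_ge) auto
    then show ?thesis by (simp add: field_simps power_one_over)
  qed
  then have "(\<Sum>j=1..J. u j) \<le> (\<Sum>j=1..J. m * (1/2) ^ j)" by (intro sum_mono)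
  also have "\<dots> = m * (\<Sum>j=1..J. (1/2) ^ j)" by (simp add: sum_distrib_left)
  also have "\<dots> \<le> m * 1" using m0 sum_half_powers_le[of J] by (intro mult_left_mono)
  finally have "(\<Sum>j=1..J. u j) powr a \<le> (2 ^ i * u i) powr a"
    using u a i by (intro powr_mono2 sum_nonneg) auto
  also have "\<dots> \<le> (\<Sum>j=1..J. (2 ^ j * u j) powr a)"
    using i(1) by (intro member_le_sum) auto
  finally show ?thesis .
qed (use a in simp)

text \<open>Powers of \<open>2 ^ j\<close> are beaten by \<open>exp (c * 4 ^ j)\<close> through
  \<open>(1 + x / n) ^ n \<le> exp x\<close> with \<open>x = c * 4 ^ j\<close>. The integer
  \<open>n\<close> is at least \<open>\<beta>\<close> to dominate the power, and at least
  \<open>1\<close> so that it can be divided by.\<close>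

lemma powr_times_exp_bounded:
  fixes \<beta> c :: real
  assumes "0 < c"
  obtains K where "0 < K" "\<And>j::nat. 2 powr (\<beta> * j) * exp (- (c * 4 ^ j)) \<le> K"
proof -
  define n where "n = nat \<lceil>max \<beta> 1\<rceil>"
  have n: "\<beta> \<le> n" "1 \<le> n" by (auto simp: n_def) linarith+
  show ?thesis
  proof (rule that)
    show "0 < (n / c) ^ n" using assms n by simp
    fix j :: nat
    have "2 powr (\<beta> * j) \<le> 2 powr (real (n * j))"
      using n by (intro powr_mono) (auto intro: mult_right_mono)
    also have "\<dots> = (2 ^ j) ^ n" by (simp add: powr_realpow mult.commute power_mult del: of_nat_mult)
    also have "\<dots> \<le> (4 ^ j) ^ n" by (intro power_mono) auto
    also have "\<dots> = (n / c) ^ n * (c * 4 ^ j / n) ^ n"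
      using n assms by (simp flip: power_mult_distrib)
    also have "\<dots> \<le> (n / c) ^ n * (1 + c * 4 ^ j / n) ^ n"
      using assms by (intro mult_left_mono power_mono) auto
    also have "\<dots> \<le> (n / c) ^ n * exp (c * 4 ^ j)"
    proof -
      have "0 < c * 4 ^ j" using assms by simp
      then have "- real n \<le> c * 4 ^ j" by linarith
      then show ?thesis
        using assms n by (intro mult_left_mono exp_ge_one_plus_x_over_n_power_n) auto
    qed
    finally show "2 powr (\<beta> * j) * exp (- (c * 4 ^ j)) \<le> (n / c) ^ n"
      by (simp add: exp_minus field_simps)
  qed
qed

text \<open>The passage opposite to \<open>scaled_ennreal_le\<close>: from averages back to plain
  norms, by cancelling the positive finite factor \<open>u\<close>.\<close>

lemma unscale_ennreal_le:
  assumes "ennreal u * x \<le> ennreal b * (ennreal v * y)" "b * v \<le> a * u" "0 < u" "0 \<le> b" "0 \<le> v" "0 \<le> a"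
  shows "x \<le> ennreal a * y"
proof -
  have "ennreal u * x \<le> ennreal (b * v) * y"
    using assms by (simp add: ennreal_mult mult.assoc)
  also have "\<dots> \<le> ennreal (a * u) * y"
    using assms by (intro mult_right_mono ennreal_leI) auto
  also have "\<dots> = ennreal u * (ennreal a * y)"
    using assms by (simp add: ennreal_mult ac_simps)
  finally show ?thesis
    using assms(3) by (simp add: ennreal_mult_le_mult_iff)
qed

section \<open>Packing bounds and finite nets\<close>

context growth_space
begin

text \<open>Volume packing: the balls of radius \<open>r / 2\<close> about the points of
  \<open>S\<close> are disjoint, lie in \<open>ball y (2 ^ (n + 2) * (r / 2))\<close>, and have
  measure at least \<open>c1 * \<phi> (r / 2)\<close> each. The upper bound involves the same
  \<open>\<phi> (r / 2)\<close>, which cancels, so the result does not depend on \<open>r\<close> or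
  \<open>y\<close>.\<close>

lemma separated_card_le:
  fixes S :: "'a set"
  assumes "0 < r" "finite S" and sep: "\<And>x x'. x \<in> S \<Longrightarrow> x' \<in> S \<Longrightarrow> x \<noteq> x' \<Longrightarrow> r \<le> dist x x'"
    and near: "\<And>x. x \<in> S \<Longrightarrow> dist x y < 2 ^ n * r"
  shows "real (card S) \<le> c2 / c1 * 2 powr (\<kappa> * (n + 2))"
proof -
  let ?s = "r / 2"
  have s: "0 < ?s" using assms by simp
  have disj: "disjoint_family_on (\<lambda>x. ball x ?s) S"
    unfolding disjoint_family_on_def
  proof (intro ballI impI)
    fix x x' assume "x \<in> S" "x' \<in> S" "x \<noteq> x'"
    with sep have "r \<le> dist x x'" by blast
    then show "ball x ?s \<inter> ball x' ?s = {}"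
    proof (intro equals0I)
      fix z assume "z \<in> ball x ?s \<inter> ball x' ?s"
      then show False using \<open>r \<le> dist x x'\<close> dist_triangle2[of x x' z] by simp
    qed
  qed
  have "(c1 * \<phi> ?s) * card S = (\<Sum>x\<in>S. c1 * \<phi> ?s)" by simp
  also have "\<dots> \<le> (\<Sum>x\<in>S. vol x ?s)" using s by (intro sum_mono growth_lower)
  also have "\<dots> = measure M (\<Union>x\<in>S. ball x ?s)"
    using disj assms(2) by (intro measure_finite_Union[symmetric]) (auto simp: emeasure_ball)
  also have "\<dots> \<le> vol y (2 ^ (n + 2) * ?s)"
  proof (intro vol_mono_set)
    show "(\<Union>x\<in>S. ball x ?s) \<subseteq> ball y (2 ^ (n + 2) * ?s)"
    proof safe
      fix x z assume "x \<in> S" "z \<in> ball x ?s"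
      then have "dist y z < 2 ^ n * r + ?s"
        using near[of x] dist_triangle[of y z x] by (auto simp: dist_commute)
      also have "\<dots> \<le> 2 ^ (n + 2) * ?s"
      proof -
        have "1 * r \<le> 2 ^ n * r" using assms(1) by (intro mult_right_mono) auto
        moreover have "2 ^ (n + 2) * ?s = 2 * (2 ^ n * r)" by simp
        ultimately show ?thesis using assms(1) by linarith
      qed
      finally show "z \<in> ball y (2 ^ (n + 2) * ?s)" by simp
    qed
  qed (use assms(2) in auto)
  also have "\<dots> \<le> 2 powr (\<kappa> * real (n + 2)) * vol y ?s"
    using s by (rule vol_pow2)
  also have "\<dots> \<le> 2 powr (\<kappa> * real (n + 2)) * (c2 * \<phi> ?s)"
    using growth_upper[OF s] by (intro mult_left_mono) auto
  finally have "\<phi> ?s * (c1 * card S) \<le> \<phi> ?s * (c2 * 2 powr (\<kappa> * (n + 2)))"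
    by (simp add: ac_simps)
  then have "c1 * card S \<le> c2 * 2 powr (\<kappa> * (n + 2))"
    using \<phi>_pos[OF s] by simp
  then show ?thesis using c1_pos by (simp add: field_simps)
qed

text \<open>Packing bounds the size of separated subsets, so one of maximal cardinality exists; a
  point of \<open>F\<close> not covered by its balls could be added to it.\<close>

lemma bounded_finite_net:
  fixes F :: "'a set"
  assumes "0 < r" "F \<subseteq> ball x0 R"
  obtains S where "finite S" "S \<subseteq> F" "F \<subseteq> (\<Union>x\<in>S. ball x r)"
    "\<And>x x'. x \<in> S \<Longrightarrow> x' \<in> S \<Longrightarrow> x \<noteq> x' \<Longrightarrow> r \<le> dist x x'"
proof -
  define P where "P S \<longleftrightarrow> finite S \<and> S \<subseteq> F \<and> (\<forall>x\<in>S. \<forall>x'\<in>S. x \<noteq> x' \<longrightarrow> r \<le> dist x x')" for S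
  obtain n :: nat where "R / r < 2 ^ n" using real_arch_pow[of 2] by auto
  then have n: "R < 2 ^ n * r" using assms by (simp add: field_simps)
  have "card S < Suc (nat \<lceil>c2 / c1 * 2 powr (\<kappa> * (n + 2))\<rceil>)" if "P S" for S
  proof -
    have "real (card S) \<le> c2 / c1 * 2 powr (\<kappa> * (n + 2))"
      using that assms n by (intro separated_card_le[where y=x0 and r=r]) (force simp: P_def dist_commute)+
    then show ?thesis by linarith
  qed
  moreover have "P {}" by (simp add: P_def)
  ultimately obtain S where S: "P S" "\<And>S'. P S' \<Longrightarrow> card S' \<le> card S"
    using ex_has_greatest_nat[of P "{}" card "Suc (nat \<lceil>c2 / c1 * 2 powr (\<kappa> * (n + 2))\<rceil>)"] by blast
  show ?thesis
  proof
    show "F \<subseteq> (\<Union>x\<in>S. ball x r)"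
    proof (rule ccontr)
      assume "\<not> F \<subseteq> (\<Union>x\<in>S. ball x r)"
      then obtain z where z: "z \<in> F" "z \<notin> (\<Union>x\<in>S. ball x r)" by blast
      then have far: "r \<le> dist x z" if "x \<in> S" for x using that by (auto simp: not_less)
      have "z \<notin> S" using far[of z] assms by auto
      moreover have "P (insert z S)" using z(1) far S(1) by (auto simp: P_def dist_commute)
      ultimately show False using S(1) S(2)[of "insert z S"] by (simp add: P_def)
    qed
  qed (use S(1) in \<open>auto simp: P_def\<close>)
qed

end

section \<open>Decomposition into shells around a ball\<close>

text \<open>The ball \<open>4B\<close> takes index \<open>1\<close>, so that for
  \<open>r > 0\<close> the shells \<open>1\<close> to \<open>J\<close> split the ball of radius
  \<open>2 ^ (J + 1) * r\<close> into disjoint pieces.\<close>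

definition shell :: "'a::metric_space \<Rightarrow> real \<Rightarrow> nat \<Rightarrow> 'a set" where
  "shell x r j = (if j = 1 then ball x (4 * r) else annulus x r j)"

lemma shell_subset_ball: "shell x r j \<subseteq> ball x (2 ^ (j + 1) * r)"
  by (auto simp: shell_def annulus_def)

context operator_family
begin

lemma shell_in_sets [measurable, simp]: "shell x r j \<in> sets M"
  by (simp add: shell_def)

text \<open>Induction on \<open>J\<close>: enlarging the ball adds one annulus, and subadditivity
  splits it off. Only finitely many pieces can be separated in this way, which is why bounded
  supports are treated first.\<close>

lemma norm_T_le_sum_shells:
  assumes "0 < t" "0 < r" "f \<in> D" "1 \<le> J"
  shows "AE y in M. norm (T t (trunc (ball x (2 ^ (J + 1) * r)) f) y)
    \<le> (\<Sum>j=1..J. norm (T t (trunc (shell x r j) f) y))"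
  using \<open>1 \<le> J\<close>
proof (induction J rule: dec_induct)
  case base
  then show ?case by (simp add: shell_def)
next
  case (step J)
  let ?f = "trunc (ball x (2 ^ (J + 1) * r)) f" and ?g = "trunc (shell x r (Suc J)) f"
  have "r * 2 ^ (J + 1) \<le> r * 2 ^ (J + 2)" using assms by (intro mult_left_mono power_increasing) auto
  then have "trunc (ball x (2 ^ (Suc J + 1) * r)) f = (\<lambda>y. ?f y + ?g y)"
    using step by (auto simp: trunc_def indicator_def shell_def annulus_def fun_eq_iff mult.commute)
  moreover have "AE y in M. norm (T t (\<lambda>y. ?f y + ?g y) y) \<le> norm (T t ?f y) + norm (T t ?g y)"
    using sublinear assms trunc_in_D[OF assms(3)] unfolding sublinear_family_def by simp
  ultimately have "AE y in M. norm (T t (trunc (ball x (2 ^ (Suc J + 1) * r)) f) y)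
      \<le> norm (T t ?f y) + norm (T t ?g y)"
    by simp
  then show ?case using step.IH
    by eventually_elim (use step in simp)
qed

text \<open>The estimates on balls at the scale \<open>sqrt t\<close>, where \<open>Upsilon\<close>
  is a power of \<open>2\<close>. Half of the exponential absorbs the powers of \<open>2 ^ j\<close>
  and yields the decay \<open>2 powr (- ((\<kappa> + 2) * j))\<close>: the \<open>\<kappa>\<close>
  will pay for the overlap of the balls, one unit for the weights \<open>2 ^ j\<close> of the crude
  Minkowski inequality, and one for a convergent geometric series. The other half is kept for
  \<open>d(E, F)\<close>.\<close>

lemma shell_estimate:
  assumes "off_diagonal_on_balls M p q D T"
  obtains K c where "0 < K" "0 < c"
    "\<And>t x f j. 0 < t \<Longrightarrow> f \<in> D \<Longrightarrow> 1 \<le> j \<Longrightarrow>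
       Lnorm M q (ball x (sqrt t)) (T t (trunc (shell x (sqrt t) j) f))
       \<le> ennreal (K * \<phi> (sqrt t) powr (recip q - recip p) * 2 powr (- ((\<kappa> + 2) * j)) * exp (- (c * 4 ^ j)))
         * Lnorm M p (shell x (sqrt t) j) f"
proof -
  obtain \<theta>1 \<theta>2 c C where
    off0: "\<forall>t>0. \<forall>x. \<forall>r>0. \<forall>f\<in>D.
        Lavg M q (ball x r) (ball x r) (T t (trunc (ball x r) f))
          \<le> ennreal (C * Upsilon (r / sqrt t) powr \<theta>2) * Lavg M p (ball x r) (ball x r) f \<and>
        (\<forall>j\<ge>2.
           Lavg M q (ball x r) (ball x r) (T t (trunc (annulus x r j) f))
             \<le> ennreal (C * 2 powr (real j * \<theta>1) * Upsilon (2 ^ j * r / sqrt t) powr \<theta>2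
                          * exp (- (c * 4 ^ j * r\<^sup>2 / t)))
                 * Lavg M p (annulus x r j) (ball x (2 ^ (j + 1) * r)) f \<and>
           Lavg M q (annulus x r j) (ball x (2 ^ (j + 1) * r)) (T t (trunc (ball x r) f))
             \<le> ennreal (C * 2 powr (real j * \<theta>1) * Upsilon (2 ^ j * r / sqrt t) powr \<theta>2
                          * exp (- (c * 4 ^ j * r\<^sup>2 / t)))
                 * Lavg M p (ball x r) (ball x r) f)"
    and pos: "0 < \<theta>1" "0 < \<theta>2" "0 < c" "0 < C"
    using assms unfolding off_diagonal_on_balls_def by (elim exE conjE) (rule that, assumption+)
  note off1 = off0[rule_format, THEN conjunct1]
  note off2 = off0[rule_format, THEN conjunct2, rule_format, THEN conjunct1]
  define \<alpha> where "\<alpha> = recip p - recip q"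
  have \<alpha>: "0 < \<alpha>" using recip_less by (simp add: \<alpha>_def)
  \<comment> \<open>The growth exponent \<open>\<theta>1 + \<theta>2\<close> together with the decay
    to be gained.\<close>
  define \<beta> where "\<beta> = \<theta>1 + \<theta>2 + \<kappa> + 2"
  obtain K0 where K0: "0 < K0" "\<And>j::nat. 2 powr (\<beta> * j) * exp (- (c / 2 * 4 ^ j)) \<le> K0"
    using powr_times_exp_bounded[of "c / 2" \<beta>] pos by auto
  define K1 where "K1 = C * c1 powr - \<alpha>"
  \<comment> \<open>\<open>K0\<close> serves \<open>j \<ge> 2\<close>. The second summand serves
    \<open>j = 1\<close>, where \<open>Upsilon\<close> equals \<open>4\<close> and the target
    contains the factors \<open>2 powr (- (\<kappa> + 2))\<close> and
    \<open>exp (- (c / 2 * 4)) = exp (- (2 * c))\<close>, to be compensated.\<close>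
  define K2 where "K2 = K0 + 4 powr \<theta>2 * 2 powr (\<kappa> + 2) * exp (2 * c)"
  have K: "0 < K1" "0 < K2" using pos c1_pos K0 by (auto simp: K1_def K2_def intro!: add_pos_pos)
  \<comment> \<open>Since \<open>1/p = \<alpha> + 1/q\<close>, the power \<open>\<alpha>\<close>
    turns into the wanted power of \<open>\<phi>\<close> by the lower growth bound, and the rest
    becomes the normalisation of the left side. The exponents are nonpositive, so larger volumes
    help.\<close>
  have vol_le: "vol x s powr - recip p \<le> c1 powr - \<alpha> * \<phi> r powr - \<alpha> * vol x s' powr - recip q"
    if "0 < r" "r \<le> s" "s' \<le> s" "r \<le> s'" for x r s s'
  proof -
    have "vol x s powr - recip p = vol x s powr - \<alpha> * vol x s powr - recip q"
      by (simp add: \<alpha>_def flip: powr_add)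
    also have "\<dots> \<le> (c1 * \<phi> r) powr - \<alpha> * vol x s' powr - recip q"
    proof (intro mult_mono powr_mono2')
      show "c1 * \<phi> r \<le> vol x s"
        using growth_lower[of r x] vol_mono[of r s x] that by simp
    qed (use \<alpha> c1_pos \<phi>_pos that vol_mono vol_pos in auto)
    finally show ?thesis by (simp add: powr_mult)
  qed
  show ?thesis
  proof (rule that[of "K1 * K2" "c / 2"])
    show "0 < K1 * K2" "0 < c / 2" using K pos by auto
    fix t :: real and x f and j :: nat assume t: "0 < t" and f: "f \<in> D" and j: "1 \<le> j"
    let ?r = "sqrt t"
    have r: "0 < ?r" using t by simp
    let ?Z = "K1 * K2 * \<phi> ?r powr (recip q - recip p) * 2 powr (- ((\<kappa> + 2) * j)) * exp (- (c / 2 * 4 ^ j))"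
    show "Lnorm M q (ball x ?r) (T t (trunc (shell x ?r j) f)) \<le> ennreal ?Z * Lnorm M p (shell x ?r j) f"
    proof (cases "j = 1")
      case True
      \<comment> \<open>The ball estimate is used on the ball of radius \<open>4 * sqrt t\<close>;
        the left side is restricted to \<open>ball x ?r\<close> only at the end.\<close>
      have s: "0 < 4 * ?r" using r by simp
      have Y: "Upsilon (4 * ?r / ?r) = 4" using r by (simp add: Upsilon_def)
      have off: "ennreal (vol x (4 * ?r) powr - recip q) *
            Lnorm M q (ball x (4 * ?r)) (T t (trunc (ball x (4 * ?r)) f))
          \<le> ennreal (C * 4 powr \<theta>2) * (ennreal (vol x (4 * ?r) powr - recip p) * Lnorm M p (ball x (4 * ?r)) f)"
        using off1[OF t s f, of x] unfolding Lavg_q_ball[OF s] Lavg_p_ball[OF s] Y .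
      have K2_le: "4 powr \<theta>2 \<le> K2 * 2 powr (- (\<kappa> + 2)) * exp (- (2 * c))"
      proof -
        have e: "2 powr (\<kappa> + 2) * 2 powr (- (\<kappa> + 2)) = 1" "exp (2 * c) * exp (- (2 * c)) = 1"
          by (simp_all only: powr_add[symmetric] exp_add[symmetric]) simp_all
        have "4 powr \<theta>2 = (4 powr \<theta>2 * 2 powr (\<kappa> + 2) * exp (2 * c)) * 2 powr (- (\<kappa> + 2)) * exp (- (2 * c))"
          by (simp only: mult.assoc mult.left_commute[of "exp (2 * c)"] e) (simp only: mult.left_commute[of "2 powr (\<kappa> + 2)"] e mult_1_right)
        also have "\<dots> \<le> K2 * 2 powr (- (\<kappa> + 2)) * exp (- (2 * c))"
          using K0 by (intro mult_right_mono) (auto simp: K2_def)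
        finally show ?thesis .
      qed
      have "C * 4 powr \<theta>2 * vol x (4 * ?r) powr - recip p
          \<le> C * 4 powr \<theta>2 * (c1 powr - \<alpha> * \<phi> ?r powr - \<alpha> * vol x (4 * ?r) powr - recip q)"
        using pos r by (intro mult_left_mono vol_le) auto
      also have "\<dots> = 4 powr \<theta>2 * (K1 * \<phi> ?r powr - \<alpha> * vol x (4 * ?r) powr - recip q)"
        by (simp add: K1_def)
      also have "\<dots> \<le> (K2 * 2 powr (- (\<kappa> + 2)) * exp (- (2 * c))) * (K1 * \<phi> ?r powr - \<alpha> * vol x (4 * ?r) powr - recip q)"
        using K by (intro mult_right_mono K2_le) auto
      also have "\<dots> = ?Z * vol x (4 * ?r) powr - recip q"
        using True by (simp add: \<alpha>_def)
      finally have le: "C * 4 powr \<theta>2 * vol x (4 * ?r) powr - recip p \<le> ?Z * vol x (4 * ?r) powr - recip q" .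
      have "Lnorm M q (ball x ?r) (T t (trunc (ball x (4 * ?r)) f))
          \<le> Lnorm M q (ball x (4 * ?r)) (T t (trunc (ball x (4 * ?r)) f))"
        using t f r by (intro Lnorm_mono_set T_measurable trunc_in_D subset_ball) auto
      also have "\<dots> \<le> ennreal ?Z * Lnorm M p (ball x (4 * ?r)) f"
        using off le vol_pos[OF s, of x] pos K by (intro unscale_ennreal_le[OF off le]) auto
      finally show ?thesis using True by (simp add: shell_def)
    next
      case False
      with j have j2: "2 \<le> j" by simp
      let ?R = "2 ^ (j + 1) * ?r"
      have s: "0 < ?R" using r by simp
      have rR: "?r \<le> ?R" using r one_le_power[of "2::real" "j + 1"] by (simp add: mult_le_cancel_right1)
      have Y: "Upsilon (2 ^ j * ?r / ?r) = 2 powr j"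
      proof -
        have "(1::real) \<le> 2 ^ j" by simp
        then have "1 / 2 ^ j \<le> (2::real) ^ j" by (simp add: field_simps flip: power_add)
        then show ?thesis using r by (simp add: Upsilon_def powr_realpow max_def)
      qed
      have ex: "c * 4 ^ j * ?r\<^sup>2 / t = c * 4 ^ j" using t by simp
      let ?b = "C * 2 powr (real j * \<theta>1) * (2 powr j) powr \<theta>2 * exp (- (c * 4 ^ j))"
      have off: "ennreal (vol x ?r powr - recip q) * Lnorm M q (ball x ?r) (T t (trunc (annulus x ?r j) f))
          \<le> ennreal ?b * (ennreal (vol x ?R powr - recip p) * Lnorm M p (annulus x ?r j) f)"
        using off2[OF t r f j2, of x] unfolding Lavg_q_ball[OF r] Lavg_p_ball[OF s] Y ex .
      \<comment> \<open>Splits \<open>exp (- (c * 4 ^ j))\<close> into two equal halves, one of them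
        grouped with \<open>2 powr (\<beta> * j)\<close>.\<close>
      have b: "?b = C * (2 powr (\<beta> * j) * exp (- (c / 2 * 4 ^ j))) * 2 powr (- ((\<kappa> + 2) * j)) * exp (- (c / 2 * 4 ^ j))"
      proof -
        have "real j * \<theta>1 + j * \<theta>2 = \<beta> * j + - ((\<kappa> + 2) * j)"
          by (simp add: \<beta>_def algebra_simps)
        then have e1: "2 powr (real j * \<theta>1) * (2 powr j) powr \<theta>2 = 2 powr (\<beta> * j) * 2 powr (- ((\<kappa> + 2) * j))"
          by (simp only: powr_powr powr_add[symmetric])
        have e2: "exp (- (c * 4 ^ j)) = exp (- (c / 2 * 4 ^ j)) * exp (- (c / 2 * 4 ^ j))"
          by (simp only: exp_add[symmetric]) simp
        have "?b = C * (2 powr (real j * \<theta>1) * (2 powr j) powr \<theta>2) * exp (- (c * 4 ^ j))"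
          by (simp only: mult.assoc)
        also have "\<dots> = C * (2 powr (\<beta> * j) * 2 powr (- ((\<kappa> + 2) * j))) * (exp (- (c / 2 * 4 ^ j)) * exp (- (c / 2 * 4 ^ j)))"
          by (simp only: e1 e2)
        finally show ?thesis by (simp only: ac_simps)
      qed
      have "?b \<le> C * K2 * 2 powr (- ((\<kappa> + 2) * j)) * exp (- (c / 2 * 4 ^ j))"
        unfolding b
      proof (intro mult_right_mono mult_left_mono)
        show "2 powr (\<beta> * j) * exp (- (c / 2 * 4 ^ j)) \<le> K2"
          using K0(2)[of j] by (rule order_trans) (simp add: K2_def)
      qed (use pos in auto)
      then have "?b * vol x ?R powr - recip p \<le> (C * K2 * 2 powr (- ((\<kappa> + 2) * j)) * exp (- (c / 2 * 4 ^ j)))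
            * (c1 powr - \<alpha> * \<phi> ?r powr - \<alpha> * vol x ?r powr - recip q)"
      proof (rule mult_mono)
        show "vol x ?R powr - recip p \<le> c1 powr - \<alpha> * \<phi> ?r powr - \<alpha> * vol x ?r powr - recip q"
          using r rR by (intro vol_le) auto
      qed (use pos K in simp_all)
      also have "\<dots> = ?Z * vol x ?r powr - recip q"
        by (simp add: K1_def \<alpha>_def)
      finally have le: "?b * vol x ?R powr - recip p \<le> ?Z * vol x ?r powr - recip q" .
      have "Lnorm M q (ball x ?r) (T t (trunc (annulus x ?r j) f)) \<le> ennreal ?Z * Lnorm M p (annulus x ?r j) f"
        using vol_pos[OF r, of x] pos K by (intro unscale_ennreal_le[OF off le]) auto
      then show ?thesis using False by (simp add: shell_def)
    qed
  qed
qed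

end

text \<open>The embedding of \<open>l^p\<close> into \<open>l^q\<close> in disguise. With
  \<open>I\<close> the integral on the right,
  \<open>I powr (q / p) = I powr ((q - p) / p) * I\<close>, and the first factor is at most
  \<open>N powr (q - p)\<close>. One plain copy of \<open>I\<close> remains, which can be summed
  over the centres.\<close>

lemma Lnorm_chain_bound:
  assumes pq: "1 \<le> p" "p < q" "q \<noteq> \<infinity>" and "0 \<le> P" "0 \<le> N"
    and g: "Lnorm M p A g \<le> ennreal N"
    and f: "Lnorm M q B f \<le> ennreal P * Lnorm M p A g"
  shows "(\<integral>\<^sup>+x\<in>B. ennreal (norm (f x) powr enn2real q) \<partial>M) \<le>
    ennreal (P powr enn2real q * N powr (enn2real q - enn2real p)) *
      (\<integral>\<^sup>+x\<in>A. ennreal (norm (g x) powr enn2real p) \<partial>M)"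
proof -
  have p: "p \<noteq> \<infinity>" using pq by auto
  have q1: "1 \<le> q" using pq by (meson less_imp_le order_trans)
  define a b where "a = enn2real q" and "b = enn2real p"
  have b: "1 \<le> b" "recip p = 1 / b" using enn2real_recip[OF pq(1) p] by (auto simp: b_def)
  have ab: "b < a"
    using p pq(2,3) by (simp add: a_def b_def enn2real_less_iff less_top)
  let ?I = "\<integral>\<^sup>+x\<in>A. ennreal (norm (g x) powr b) \<partial>M"
  have "?I \<le> ennreal (N powr b)"
    using g pq(1) p assms(5) by (simp add: Lnorm_le_iff_finite b_def)
  then obtain i where i: "?I = ennreal i" "0 \<le> i" "i \<le> N powr b"
    by (cases ?I) (auto simp: top_unique)
  have "Lnorm M p A g = ennreal (i powr (1 / b))"
    using p i b(2) by (simp add: Lnorm_def epow_def flip: b_def)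
  with f have "Lnorm M q B f \<le> ennreal (P * i powr (1 / b))"
    using assms(4) by (simp add: ennreal_mult)
  then have "(\<integral>\<^sup>+x\<in>B. ennreal (norm (f x) powr a) \<partial>M) \<le> ennreal ((P * i powr (1 / b)) powr a)"
    using q1 pq(3) assms(4) by (simp add: Lnorm_le_iff_finite a_def)
  also have "(P * i powr (1 / b)) powr a = P powr a * (i powr ((a - b) / b) * i)"
  proof -
    have "i powr (a / b) = i powr ((a - b) / b + 1)"
      using b(1) by (simp add: diff_divide_distrib)
    also have "\<dots> = i powr ((a - b) / b) * i"
      using i(2) by (cases "i = 0") (simp_all add: powr_add)
    finally show ?thesis using assms(4) by (simp add: powr_mult powr_powr)
  qed
  also have "\<dots> \<le> P powr a * (N powr (a - b) * i)"
  proof -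
    have "i powr ((a - b) / b) \<le> (N powr b) powr ((a - b) / b)"
      using i ab b(1) by (intro powr_mono2) auto
    also have "\<dots> = N powr (a - b)" using b(1) by (simp add: powr_powr)
    finally show ?thesis using i by (intro mult_left_mono mult_right_mono) auto
  qed
  finally have "(\<integral>\<^sup>+x\<in>B. ennreal (norm (f x) powr a) \<partial>M) \<le> ennreal (P powr a * N powr (a - b) * i)"
    by (simp add: ennreal_leI mult.assoc)
  then show ?thesis
    using i by (simp add: a_def b_def ennreal_mult)
qed

section \<open>Summation over separated centres\<close>

context growth_space
begin

text \<open>The sum and the integral are interchanged; by \<open>separated_card_le\<close> each
  point lies in a controlled number of the balls.\<close>

lemma sum_nn_integral_balls_le:
  assumes [measurable]: "h \<in> borel_measurable M" and "0 < r" "finite S"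
    and sep: "\<And>x x'. x \<in> S \<Longrightarrow> x' \<in> S \<Longrightarrow> x \<noteq> x' \<Longrightarrow> r \<le> dist x x'"
  shows "(\<Sum>x\<in>S. \<integral>\<^sup>+y\<in>ball x (2 ^ n * r). h y \<partial>M) \<le>
    ennreal (c2 / c1 * 2 powr (\<kappa> * (n + 2))) * (\<integral>\<^sup>+y. h y \<partial>M)"
proof -
  let ?C = "c2 / c1 * 2 powr (\<kappa> * (n + 2))"
  have "(\<Sum>x\<in>S. \<integral>\<^sup>+y\<in>ball x (2 ^ n * r). h y \<partial>M)
      = (\<integral>\<^sup>+y. (\<Sum>x\<in>S. h y * indicator (ball x (2 ^ n * r)) y) \<partial>M)"
    by (intro nn_integral_sum[symmetric]) measurable
  also have "\<dots> \<le> (\<integral>\<^sup>+y. ennreal ?C * h y \<partial>M)"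
  proof (intro nn_integral_mono)
    fix y
    let ?S = "{x\<in>S. dist x y < 2 ^ n * r}"
    have "(\<Sum>x\<in>S. h y * indicator (ball x (2 ^ n * r)) y) = h y * (\<Sum>x\<in>S. indicator ?S x)"
      by (simp add: sum_distrib_left indicator_def)
    also have "(\<Sum>x\<in>S. indicator ?S x) = (of_nat (card ?S) :: ennreal)"
    proof -
      have "(\<Sum>x\<in>S. indicator ?S x) = (\<Sum>x\<in>S. if dist x y < 2 ^ n * r then 1 else 0 :: ennreal)"
        by (intro sum.cong) (auto simp: indicator_def)
      also have "\<dots> = (\<Sum>x\<in>?S. 1)" by (rule sum.inter_filter[OF assms(3), symmetric])
      finally show ?thesis by simp
    qed
    also have "h y * of_nat (card ?S) \<le> h y * ennreal ?C"
    proof (intro mult_left_mono)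
      have "real (card ?S) \<le> ?C"
        using assms by (intro separated_card_le[where y=y and r=r]) auto
      then show "of_nat (card ?S) \<le> ennreal ?C"
        unfolding ennreal_of_nat_eq_real_of_nat by (rule ennreal_leI)
    qed simp
    finally show "(\<Sum>x\<in>S. h y * indicator (ball x (2 ^ n * r)) y) \<le> ennreal ?C * h y"
      by (simp only: mult.commute)
  qed
  also have "\<dots> = ennreal ?C * (\<integral>\<^sup>+y. h y \<partial>M)"
    by (intro nn_integral_cmult) measurable
  finally show ?thesis .
qed

end

section \<open>The estimate for bounded sets\<close>

context operator_family
begin

text \<open>The core of the converse direction. Boundedness makes the net and the number of shells
  finite, but neither \<open>x0\<close> nor \<open>R\<close> enters the constant, so a limit in
  \<open>R\<close> remains possible. The shell estimate is a hypothesis about the single function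
  \<open>trunc E f\<close>, and \<open>d\<close> is any lower bound for the distance.\<close>

lemma bounded_estimate:
  assumes Kc: "0 < K" "0 < c"
    and shell: "\<And>x j. 1 \<le> j \<Longrightarrow> Lnorm M q (ball x (sqrt t)) (T t (trunc (shell x (sqrt t) j) (trunc E f)))
       \<le> ennreal (K * \<phi> (sqrt t) powr (recip q - recip p) * 2 powr (- ((\<kappa> + 2) * j)) * exp (- (c * 4 ^ j)))
         * Lnorm M p (shell x (sqrt t) j) (trunc E f)"
    and t: "0 < t" and f: "f \<in> D"
    and [measurable]: "E \<in> sets M" "F \<in> sets M"
    and bounded: "E \<subseteq> ball x0 R" "F \<subseteq> ball x0 R"
    and d: "0 \<le> d" "\<And>x y. x \<in> E \<Longrightarrow> y \<in> F \<Longrightarrow> d \<le> dist x y"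
    and N: "0 \<le> N" "Lnorm M p E f \<le> ennreal N"
  shows "Lnorm M q F (T t (trunc E f)) \<le>
    ennreal ((1 + c2 / c1 * 2 powr (3 * \<kappa>)) * (K * \<phi> (sqrt t) powr (recip q - recip p) * exp (- (c / 4 * d\<^sup>2 / t))) * N)"
proof -
  define r where "r = sqrt t"
  define g where "g = trunc E f"
  define P where "P = K * \<phi> r powr (recip q - recip p) * exp (- (c / 4 * d\<^sup>2 / t))"
  define A where "A = 1 + c2 / c1 * 2 powr (3 * \<kappa>)"
  have r: "0 < r" "r\<^sup>2 = t" using t by (auto simp: r_def)
  have P: "0 \<le> P" using Kc by (simp add: P_def)
  have A: "1 \<le> A" using c1_pos c2_pos by (simp add: A_def)
  have g: "g \<in> D" using f by (simp add: g_def trunc_in_D)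
  note [measurable] = D_measurable[OF g] T_measurable[OF t g]
  have gN: "Lnorm M p B g \<le> ennreal N" if [measurable]: "B \<in> sets M" for B
  proof -
    have "Lnorm M p B g \<le> Lnorm M p E f"
      unfolding g_def Lnorm_trunc using f by (intro Lnorm_mono_set D_measurable) auto
    with N(2) show ?thesis by simp
  qed
  have Tj_measurable: "T t (trunc (shell x r j) g) \<in> borel_measurable M" for x j
    using t g by (intro T_measurable trunc_in_D) auto
  note [measurable] = Tj_measurable
  obtain S where S: "finite S" "S \<subseteq> F" "F \<subseteq> (\<Union>x\<in>S. ball x r)"
    and sep: "\<And>x x'. x \<in> S \<Longrightarrow> x' \<in> S \<Longrightarrow> x \<noteq> x' \<Longrightarrow> r \<le> dist x x'"
    by (rule bounded_finite_net[OF r(1) bounded(2)]) (rule that)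
  \<comment> \<open>\<open>E\<close> and the centres lie in \<open>ball x0 R\<close>, so radius
    \<open>2 * R\<close> about any centre reaches all of \<open>E\<close>; \<open>J\<close> is
    chosen accordingly.\<close>
  obtain J0 :: nat where "2 * R / r < 2 ^ J0" using real_arch_pow[of 2] by auto
  define J where "J = Suc J0"
  have "2 * R < 2 ^ J0 * r" using \<open>2 * R / r < 2 ^ J0\<close> r by (simp add: field_simps)
  also have "\<dots> \<le> 2 ^ (J + 1) * r"
    using r by (intro mult_right_mono power_increasing) (auto simp: J_def)
  finally have J: "1 \<le> J" "2 * R < 2 ^ (J + 1) * r" by (auto simp: J_def)
  have dominated: "AE y in M. norm (T t g y) \<le> (\<Sum>j=1..J. norm (T t (trunc (shell x r j) g) y))"
    if "x \<in> S" for x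
  proof -
    have "E \<subseteq> ball x (2 ^ (J + 1) * r)"
    proof
      fix y assume "y \<in> E"
      then have "dist x0 y < R" "dist x0 x < R" using bounded S(2) \<open>x \<in> S\<close> by auto
      then show "y \<in> ball x (2 ^ (J + 1) * r)"
        using dist_triangle3[of x y x0] J(2) by simp
    qed
    then have "trunc (ball x (2 ^ (J + 1) * r)) g = g"
      by (simp add: g_def trunc_trunc Int_absorb1)
    with norm_T_le_sum_shells[OF t r(1) g J(1), of x] show ?thesis by simp
  qed
  have near: "Lnorm M q (ball x r) (T t (trunc (shell x r j) g))
      \<le> ennreal (P * 2 powr (- ((\<kappa> + 2) * j))) * Lnorm M p (ball x (2 ^ (j + 1) * r)) g"
    if "x \<in> S" "1 \<le> j" for x and j :: nat
  proof -
    let ?L = "Lnorm M p (ball x (2 ^ (j + 1) * r)) g"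
    have "Lnorm M q (ball x r) (T t (trunc (shell x r j) g))
       \<le> ennreal (K * \<phi> r powr (recip q - recip p) * 2 powr (- ((\<kappa> + 2) * j)) * exp (- (c * 4 ^ j)))
         * Lnorm M p (shell x r j) g"
      using shell[OF that(2), of x] by (simp add: r_def g_def)
    also have "\<dots> \<le> ennreal (K * \<phi> r powr (recip q - recip p) * 2 powr (- ((\<kappa> + 2) * j)) * exp (- (c * 4 ^ j))) * ?L"
      by (intro mult_left_mono Lnorm_mono_set shell_subset_ball) auto
    also have "\<dots> \<le> ennreal (P * 2 powr (- ((\<kappa> + 2) * j))) * ?L"
    \<comment> \<open>If the enlarged ball misses \<open>E\<close>, the norm of \<open>g\<close> on
      it is \<open>0\<close>. Otherwise a point of \<open>E\<close> lies within
      \<open>2 ^ (j + 1) * r\<close> of the centre \<open>x \<in> F\<close>, so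
      \<open>d\<^sup>2 / t \<le> 4 * 4 ^ j\<close>; this factor \<open>4\<close> explains
      \<open>c / 4\<close>.\<close>
    proof (cases "ball x (2 ^ (j + 1) * r) \<inter> E = {}")
      case True
      then show ?thesis by (simp add: g_def Lnorm_trunc)
    next
      case False
      then obtain y where y: "y \<in> E" "dist x y < 2 ^ (j + 1) * r" by auto
      have "d \<le> dist y x" using d(2)[OF y(1)] that S(2) by auto
      with y have "d \<le> 2 ^ (j + 1) * r" by (simp add: dist_commute)
      then have "d\<^sup>2 \<le> (2 ^ (j + 1) * r)\<^sup>2" using d(1) by (rule power_mono)
      also have "\<dots> = (2 ^ (j + 1))\<^sup>2 * t" using r(2) by (simp add: power_mult_distrib)
      also have "((2::real) ^ (j + 1))\<^sup>2 = 4 * 4 ^ j"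
        by (simp add: power2_eq_square flip: power_mult_distrib)
      finally have "d\<^sup>2 / t \<le> 4 * 4 ^ j" using t by (simp add: field_simps)
      then have "c / 4 * (d\<^sup>2 / t) \<le> c / 4 * (4 * 4 ^ j)" using Kc by (intro mult_left_mono) auto
      then have "exp (- (c * 4 ^ j)) \<le> exp (- (c / 4 * d\<^sup>2 / t))" by simp
      then have "K * \<phi> r powr (recip q - recip p) * 2 powr (- ((\<kappa> + 2) * j)) * exp (- (c * 4 ^ j))
          \<le> K * \<phi> r powr (recip q - recip p) * 2 powr (- ((\<kappa> + 2) * j)) * exp (- (c / 4 * d\<^sup>2 / t))"
        using Kc by (intro mult_left_mono) auto
      also have "\<dots> = P * 2 powr (- ((\<kappa> + 2) * j))" by (simp add: P_def)
      finally show ?thesis by (intro mult_right_mono ennreal_leI) auto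
    qed
    finally show ?thesis .
  qed
  have "Lnorm M q F (T t g) \<le> ennreal (A * P * N)"
  proof (cases "q = \<infinity>")
    case True
    \<comment> \<open>For \<open>q = \<infinity>\<close> the centres need not be summed: on each
      ball the shell of index \<open>j\<close> contributes at most
      \<open>P * N * (1/2) ^ j\<close>.\<close>
    have "AE y in M. y \<in> ball x r \<longrightarrow> norm (T t g y) \<le> P * N" if x: "x \<in> S" for x
    proof -
      have "AE y in M. y \<in> ball x r \<longrightarrow> norm (T t (trunc (shell x r j) g) y) \<le> P * N * (1/2) ^ j"
        if j: "1 \<le> j" for j
      proof -
        have "2 powr (- ((\<kappa> + 2) * j)) \<le> 2 powr (- real j)"
        proof (intro powr_mono)
          have "1 * real j \<le> (\<kappa> + 2) * real j" using \<kappa>_pos by (intro mult_right_mono) auto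
          then show "- ((\<kappa> + 2) * j) \<le> - real j" by simp
        qed simp
        also have "\<dots> = (1/2) ^ j"
          by (simp add: powr_minus powr_realpow power_one_over inverse_eq_divide)
        finally have "P * 2 powr (- ((\<kappa> + 2) * j)) * N \<le> P * (1/2) ^ j * N"
          using P N by (intro mult_left_mono mult_right_mono) auto
        then have le: "P * 2 powr (- ((\<kappa> + 2) * j)) * N \<le> P * N * (1/2) ^ j"
          by (simp only: ac_simps)
        have "Lnorm M top (ball x r) (T t (trunc (shell x r j) g))
            \<le> ennreal (P * 2 powr (- ((\<kappa> + 2) * j))) * Lnorm M p (ball x (2 ^ (j + 1) * r)) g"
          using near[OF x j] True by simp
        also have "\<dots> \<le> ennreal (P * 2 powr (- ((\<kappa> + 2) * j))) * ennreal N"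
          by (intro mult_left_mono gN) auto
        also have "\<dots> = ennreal (P * 2 powr (- ((\<kappa> + 2) * j)) * N)"
          using P N by (simp add: ennreal_mult)
        also have "\<dots> \<le> ennreal (P * N * (1/2) ^ j)"
          by (rule ennreal_leI) (rule le)
        finally show ?thesis
          using P N by (subst (asm) Lnorm_le_iff_top) auto
      qed
      then have "AE y in M. \<forall>j\<in>{1..J}. y \<in> ball x r \<longrightarrow> norm (T t (trunc (shell x r j) g) y) \<le> P * N * (1/2) ^ j"
        by (intro AE_finite_allI) auto
      with dominated[OF x] show ?thesis
      proof eventually_elim
        case (elim y)
        show ?case
        proof
          assume y: "y \<in> ball x r"
          have "norm (T t g y) \<le> (\<Sum>j=1..J. norm (T t (trunc (shell x r j) g) y))" by (rule elim)
          also have "\<dots> \<le> (\<Sum>j=1..J. P * N * (1/2) ^ j)" using elim(2) y by (intro sum_mono) auto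
          also have "\<dots> = P * N * (\<Sum>j=1..J. (1/2) ^ j)" by (simp add: sum_distrib_left)
          also have "\<dots> \<le> P * N * 1" using P N sum_half_powers_le[of J] by (intro mult_left_mono) auto
          finally show "norm (T t g y) \<le> P * N" by simp
        qed
      qed
    qed
    then have "AE y in M. \<forall>x\<in>S. y \<in> ball x r \<longrightarrow> norm (T t g y) \<le> P * N"
      using S(1) by (intro AE_finite_allI)
    then have "AE y in M. y \<in> F \<longrightarrow> norm (T t g y) \<le> P * N"
      using S(3) by (auto elim!: eventually_mono)
    moreover have "P * N \<le> A * P * N" using A P N by (simp add: mult_right_mono mult_le_cancel_right1)
    ultimately have "AE y in M. y \<in> F \<longrightarrow> norm (T t g y) \<le> A * P * N"
      by (auto elim!: eventually_mono)
    then show ?thesis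
      using A P N True by (simp add: Lnorm_le_iff_top)
  next
    case False
    define a b where "a = enn2real q" and "b = enn2real p"
    have a: "1 \<le> a" using enn2real_recip[OF q_ge_1 False] by (simp add: a_def)
    have b: "1 \<le> b" using enn2real_recip[OF p_ge_1 p_finite] by (simp add: b_def)
    let ?G = "\<lambda>x j. \<integral>\<^sup>+y\<in>ball x (2 ^ (j + 1) * r). ennreal (norm (g y) powr b) \<partial>M"
    \<comment> \<open>What is left of the decay after the weights \<open>(2 ^ j) powr a\<close> are
      paid. The exponent \<open>a\<close> on this power of \<open>2\<close> is dropped, since
      \<open>a \<ge> 1\<close>.\<close>
    let ?w = "\<lambda>j. 2 powr (- ((\<kappa> + 1) * real j)) * P powr a * N powr (a - b)"
    have shell_int: "ennreal ((2 ^ j) powr a) *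
        (\<integral>\<^sup>+y\<in>ball x r. ennreal (norm (T t (trunc (shell x r j) g) y) powr a) \<partial>M) \<le> ennreal (?w j) * ?G x j"
      if "x \<in> S" "1 \<le> j" for x and j :: nat
    proof -
      have "(\<integral>\<^sup>+y\<in>ball x r. ennreal (norm (T t (trunc (shell x r j) g) y) powr a) \<partial>M)
        \<le> ennreal ((P * 2 powr (- ((\<kappa> + 2) * j))) powr a * N powr (a - b)) * ?G x j"
        unfolding a_def b_def
        using near[OF that] P N gN False p_ge_1 p_less_q by (intro Lnorm_chain_bound) auto
      then have "ennreal ((2 ^ j) powr a) *
          (\<integral>\<^sup>+y\<in>ball x r. ennreal (norm (T t (trunc (shell x r j) g) y) powr a) \<partial>M)
        \<le> ennreal ((2 ^ j) powr a) * (ennreal ((P * 2 powr (- ((\<kappa> + 2) * j))) powr a * N powr (a - b)) * ?G x j)"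
        by (rule mult_left_mono) simp
      also have "\<dots> = ennreal ((2 ^ j) powr a * ((P * 2 powr (- ((\<kappa> + 2) * j))) powr a * N powr (a - b))) * ?G x j"
        by (simp add: ennreal_mult mult.assoc)
      also have "\<dots> \<le> ennreal (?w j) * ?G x j"
      proof (intro mult_right_mono ennreal_leI)
        have "(2 ^ j) powr a * ((P * 2 powr (- ((\<kappa> + 2) * j))) powr a * N powr (a - b))
            = ((2 powr j * 2 powr (- ((\<kappa> + 2) * j))) powr a) * (P powr a * N powr (a - b))"
          using P by (simp add: powr_mult powr_realpow)
        also have "2 powr j * 2 powr (- ((\<kappa> + 2) * j)) = 2 powr (- ((\<kappa> + 1) * real j))"
          by (simp add: algebra_simps flip: powr_add)
        also have "(2 powr (- ((\<kappa> + 1) * real j))) powr a \<le> 2 powr (- ((\<kappa> + 1) * real j))"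
        proof -
          have "(\<kappa> + 1) * real j * 1 \<le> (\<kappa> + 1) * real j * a"
            using a \<kappa>_pos by (intro mult_left_mono) auto
          then show ?thesis by (simp add: powr_powr)
        qed
        finally show "(2 ^ j) powr a * ((P * 2 powr (- ((\<kappa> + 2) * j))) powr a * N powr (a - b)) \<le> ?w j"
          by (simp add: mult_right_mono mult.assoc)
      qed auto
      finally show ?thesis .
    qed
    \<comment> \<open>Bounded overlap of the balls of radius \<open>2 ^ n * r\<close> with
      \<open>n = j + 1\<close>, hence the exponent \<open>\<kappa> * (j + 3)\<close>.\<close>
    have G_sum: "(\<Sum>x\<in>S. ?G x j) \<le> ennreal (c2 / c1 * 2 powr (\<kappa> * (j + 3)) * N powr b)" for j :: nat
    proof -
      have "(\<Sum>x\<in>S. ?G x j) \<le> ennreal (c2 / c1 * 2 powr (\<kappa> * real (j + 1 + 2))) * (\<integral>\<^sup>+y. ennreal (norm (g y) powr b) \<partial>M)"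
        by (rule sum_nn_integral_balls_le[OF _ r(1) S(1) sep]) auto
      also have "\<dots> \<le> ennreal (c2 / c1 * 2 powr (\<kappa> * real (j + 1 + 2))) * ennreal (N powr b)"
        using gN[of UNIV] N(1) p_ge_1 p_finite
        by (intro mult_left_mono) (auto simp: sets_M Lnorm_le_iff_finite b_def)
      also have "\<dots> = ennreal (c2 / c1 * 2 powr (\<kappa> * real (j + 1 + 2)) * N powr b)"
        using c1_pos c2_pos by (intro ennreal_mult[symmetric]) auto
      also have "real (j + 1 + 2) = j + 3" by simp
      finally show ?thesis .
    qed
    have cover: "ennreal (norm (T t g y) powr a) * indicator F y
      \<le> (\<Sum>x\<in>S. ennreal (norm (T t g y) powr a) * indicator (ball x r) y)" for y
    proof (cases "y \<in> F")
      case True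
      then obtain x where x: "x \<in> S" "y \<in> ball x r" using S(3) by auto
      have "ennreal (norm (T t g y) powr a) * indicator (ball x r) y
        \<le> (\<Sum>x\<in>S. ennreal (norm (T t g y) powr a) * indicator (ball x r) y)"
        using S(1) x(1) by (intro member_le_sum) auto
      with x True show ?thesis by simp
    qed simp
    have "(\<integral>\<^sup>+y\<in>F. ennreal (norm (T t g y) powr a) \<partial>M)
      \<le> (\<integral>\<^sup>+y. (\<Sum>x\<in>S. ennreal (norm (T t g y) powr a) * indicator (ball x r) y) \<partial>M)"
      by (intro nn_integral_mono cover)
    also have "\<dots> = (\<Sum>x\<in>S. \<integral>\<^sup>+y\<in>ball x r. ennreal (norm (T t g y) powr a) \<partial>M)"
      by (intro nn_integral_sum) measurable
    also have "\<dots> \<le> (\<Sum>x\<in>S. \<Sum>j=1..J. ennreal (?w j) * ?G x j)"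
    proof (intro sum_mono)
      fix x assume x: "x \<in> S"
      have "(\<integral>\<^sup>+y\<in>ball x r. ennreal (norm (T t g y) powr a) \<partial>M)
        \<le> (\<integral>\<^sup>+y. (\<Sum>j=1..J. ennreal ((2 ^ j) powr a) *
             (ennreal (norm (T t (trunc (shell x r j) g) y) powr a) * indicator (ball x r) y)) \<partial>M)"
      proof (intro nn_integral_mono_AE)
        show "AE y in M. ennreal (norm (T t g y) powr a) * indicator (ball x r) y \<le>
            (\<Sum>j=1..J. ennreal ((2 ^ j) powr a) *
               (ennreal (norm (T t (trunc (shell x r j) g) y) powr a) * indicator (ball x r) y))"
          \<comment> \<open>Pointwise, \<open>powr_sum_le_sum_powr\<close> replaces the power of the
            sum by a sum of weighted powers, so the integral splits over the shells.\<close>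
          using dominated[OF x]
        proof eventually_elim
          case (elim y)
          let ?u = "\<lambda>j. norm (T t (trunc (shell x r j) g) y)"
          have "norm (T t g y) powr a \<le> (\<Sum>j=1..J. ?u j) powr a"
            using elim a by (intro powr_mono2) auto
          also have "\<dots> \<le> (\<Sum>j=1..J. (2 ^ j * ?u j) powr a)"
            using a by (intro powr_sum_le_sum_powr) auto
          finally have "ennreal (norm (T t g y) powr a) \<le> (\<Sum>j=1..J. ennreal ((2 ^ j) powr a) * ennreal (?u j powr a))"
            by (simp add: powr_mult ennreal_leI flip: ennreal_mult)
          then show ?case
            by (cases "y \<in> ball x r") auto
        qed
      qed
      also have "\<dots> = (\<Sum>j=1..J. ennreal ((2 ^ j) powr a) *
          (\<integral>\<^sup>+y\<in>ball x r. ennreal (norm (T t (trunc (shell x r j) g) y) powr a) \<partial>M))"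
        by (subst nn_integral_sum) (auto intro!: sum.cong nn_integral_cmult)
      also have "\<dots> \<le> (\<Sum>j=1..J. ennreal (?w j) * ?G x j)"
        using x by (intro sum_mono shell_int) auto
      finally show "(\<integral>\<^sup>+y\<in>ball x r. ennreal (norm (T t g y) powr a) \<partial>M) \<le> \<dots>" .
    qed
    also have "\<dots> = (\<Sum>j=1..J. ennreal (?w j) * (\<Sum>x\<in>S. ?G x j))"
      by (subst sum.swap) (simp add: sum_distrib_left)
    also have "\<dots> \<le> (\<Sum>j=1..J. ennreal (A * (P * N) powr a * (1/2) ^ j))"
    proof (intro sum_mono)
      fix j assume "j \<in> {1..J}"
      have "ennreal (?w j) * (\<Sum>x\<in>S. ?G x j) \<le> ennreal (?w j) * ennreal (c2 / c1 * 2 powr (\<kappa> * (j + 3)) * N powr b)"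
        by (intro mult_left_mono G_sum) auto
      also have "\<dots> = ennreal (?w j * (c2 / c1 * 2 powr (\<kappa> * (j + 3)) * N powr b))"
        using c1_pos c2_pos by (intro ennreal_mult[symmetric]) auto
      also have "?w j * (c2 / c1 * 2 powr (\<kappa> * (j + 3)) * N powr b)
          = c2 / c1 * (2 powr (- ((\<kappa> + 1) * real j)) * 2 powr (\<kappa> * (j + 3))) * (P powr a * (N powr (a - b) * N powr b))"
        by (simp only: ac_simps)
      \<comment> \<open>The decay outweighs the overlap by exactly one factor
        \<open>2 powr (- real j)\<close>, which bounds the sum over the shells uniformly in
        \<open>J\<close>.\<close>
      also have "2 powr (- ((\<kappa> + 1) * real j)) * 2 powr (\<kappa> * (j + 3)) = 2 powr (3 * \<kappa>) * 2 powr (- real j)"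
        by (simp add: algebra_simps flip: powr_add)
      also have "2 powr (- real j) = (1/2) ^ j"
        by (simp add: powr_minus powr_realpow power_one_over inverse_eq_divide)
      also have "P powr a * (N powr (a - b) * N powr b) = (P * N) powr a"
        using P N by (simp add: powr_mult flip: powr_add)
      also have "c2 / c1 * (2 powr (3 * \<kappa>) * (1/2) ^ j) * (P * N) powr a
          = (c2 / c1 * 2 powr (3 * \<kappa>)) * (P * N) powr a * (1/2) ^ j"
        by (simp only: ac_simps)
      also have "\<dots> \<le> A * (P * N) powr a * (1/2) ^ j"
        by (intro mult_right_mono) (auto simp: A_def)
      finally show "ennreal (?w j) * (\<Sum>x\<in>S. ?G x j) \<le> ennreal (A * (P * N) powr a * (1/2) ^ j)"
        by (simp add: ennreal_leI)
    qed
    also have "\<dots> = ennreal (\<Sum>j=1..J. A * (P * N) powr a * (1/2) ^ j)"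
      using A by (intro sum_ennreal) auto
    also have "\<dots> \<le> ennreal ((A * P * N) powr a)"
    proof (intro ennreal_leI)
      have "(\<Sum>j=1..J. A * (P * N) powr a * (1/2) ^ j) = A * (P * N) powr a * (\<Sum>j=1..J. (1/2) ^ j)"
        by (simp add: sum_distrib_left)
      also have "\<dots> \<le> A * (P * N) powr a * 1"
        using A sum_half_powers_le[of J] by (intro mult_left_mono) auto
      \<comment> \<open>Uses \<open>A \<ge> 1\<close> and \<open>a \<ge> 1\<close>; the summand
        \<open>1\<close> in \<open>A\<close> ensures the former.\<close>
      also have "\<dots> \<le> A powr a * (P * N) powr a"
      proof -
        have "A powr 1 \<le> A powr a" using A a by (intro powr_mono) auto
        then show ?thesis using A by (simp add: mult_right_mono)
      qed
      also have "\<dots> = (A * P * N) powr a"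
        using A P N by (simp add: powr_mult mult.assoc)
      finally show "(\<Sum>j=1..J. A * (P * N) powr a * (1/2) ^ j) \<le> (A * P * N) powr a" .
    qed
    finally show ?thesis
      using A P N False q_ge_1 by (simp add: Lnorm_le_iff_finite a_def)
  qed
  then show ?thesis by (simp add: A_def P_def r_def g_def)
qed

end

section \<open>Norms for the null measure\<close>

lemma Lnorm_null_measure:
  assumes "emeasure M (space M) = 0" and [measurable]: "A \<in> sets M" "g \<in> borel_measurable M"
  shows "Lnorm M q A g = 0" "Lavg M q A N g = 0"
proof -
  have AE: "AE x in M. P x" for P
    using assms(1) by (intro AE_I[of _ _ "space M"]) auto
  have "esssup M (\<lambda>x. ennreal (norm (g x)) * indicator A x) \<le> 0"
    by (intro esssup_I AE) measurable
  moreover have "(\<integral>\<^sup>+x\<in>A. ennreal (norm (g x) powr a) \<partial>M) = 0" for a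
    using nn_integral_cong_AE[OF AE, of "\<lambda>x. ennreal (norm (g x) powr a) * indicator A x" "\<lambda>_. 0"] by simp
  ultimately show "Lnorm M q A g = 0" "Lavg M q A N g = 0"
    by (auto simp: Lnorm_def Lavg_def epow_def)
qed

section \<open>Removing the boundedness of the sets\<close>

context operator_family
begin

text \<open>\<open>bounded_estimate\<close> on the parts of \<open>E\<close> and \<open>F\<close> in
  large balls, with \<open>d = setdist E F\<close>, gives a bound independent of the ball. Control
  by truncations and \<open>Lnorm_le_liminf\<close> carry it over to the whole sets.\<close>

lemma balls_imp_full:
  assumes balls: "off_diagonal_on_balls M p q D T" and ctrl: "controlled_by_truncations M p D T"
  shows "full_off_diagonal M \<phi> p q D T"
proof -
  obtain K c where Kc: "0 < K" "0 < c"
    and shell: "\<And>t x f j. 0 < t \<Longrightarrow> f \<in> D \<Longrightarrow> 1 \<le> j \<Longrightarrow>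
       Lnorm M q (ball x (sqrt t)) (T t (trunc (shell x (sqrt t) j) f))
       \<le> ennreal (K * \<phi> (sqrt t) powr (recip q - recip p) * 2 powr (- ((\<kappa> + 2) * j)) * exp (- (c * 4 ^ j)))
         * Lnorm M p (shell x (sqrt t) j) f"
    by (rule shell_estimate[OF balls]) (rule that)
  define A where "A = 1 + c2 / c1 * 2 powr (3 * \<kappa>)"
  have A: "0 < A" using c1_pos c2_pos by (simp add: A_def add_pos_pos)
  have main: "Lnorm M q F (T t (trunc E f))
      \<le> ennreal (A * K * \<phi> (sqrt t) powr (recip q - recip p) * exp (- (c / 4 * (setdist E F)\<^sup>2 / t)))
        * Lnorm M p E f"
    if EF: "closed E" "closed F" and f: "f \<in> D" and t: "0 < t" for E F f t
  proof -
    let ?Z = "A * K * \<phi> (sqrt t) powr (recip q - recip p) * exp (- (c / 4 * (setdist E F)\<^sup>2 / t))"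
    have Z: "0 < ?Z" using A Kc \<phi>_pos[of "sqrt t"] t by simp
    note [measurable] = closed_in_sets[OF EF(1)] closed_in_sets[OF EF(2)]
    show ?thesis
    proof (cases "Lnorm M p E f")
      \<comment> \<open>The constant is positive, so the right-hand side is infinite.\<close>
      case top
      then show ?thesis using A Kc \<phi>_pos[of "sqrt t"] t by (simp add: ennreal_mult_top)
    next
      case (real N)
      let ?g = "trunc E f"
      have g: "?g \<in> D" using f by (simp add: trunc_in_D)
      \<comment> \<open>Control by truncations requires a finite norm on the whole space, so it is
        applied to \<open>trunc E f\<close> rather than to \<open>f\<close>.\<close>
      have "Lnorm M p UNIV ?g < \<infinity>" using real by (simp add: Lnorm_trunc)
      then obtain x0 and R :: "nat \<Rightarrow> real" where R: "filterlim R at_top sequentially"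
        and lim: "AE x in M. ennreal (norm (T t ?g x))
           \<le> liminf (\<lambda>k. ennreal (norm (T t (trunc (ball x0 (R k)) ?g) x)))"
        using ctrl g t unfolding controlled_by_truncations_def by blast
      have "Lnorm M q F (T t ?g) \<le> ennreal (?Z * N)"
      proof (rule Lnorm_le_liminf[OF q_ge_1 _ _ _ _ _ _ _ lim])
        fix k
        have "Lnorm M q (F \<inter> ball x0 (R k)) (T t (trunc (E \<inter> ball x0 (R k)) f)) \<le>
          ennreal (A * (K * \<phi> (sqrt t) powr (recip q - recip p) * exp (- (c / 4 * (setdist E F)\<^sup>2 / t))) * N)"
          unfolding A_def
        proof (rule bounded_estimate[OF Kc shell t f, where R = "R k" and ?x0.0 = x0])
          have "Lnorm M p (E \<inter> ball x0 (R k)) f \<le> Lnorm M p E f"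
            using f by (intro Lnorm_mono_set D_measurable) auto
          then show "Lnorm M p (E \<inter> ball x0 (R k)) f \<le> ennreal N" using real by simp
        qed (use t f real in \<open>auto simp: trunc_in_D setdist_le_dist\<close>)
        then show "Lnorm M q (F \<inter> ball x0 (R k)) (T t (trunc (ball x0 (R k)) ?g)) \<le> ennreal (?Z * N)"
          by (simp add: trunc_trunc Int_commute mult.assoc)
      next
        fix x assume "x \<in> F"
        have "eventually (\<lambda>k. dist x0 x < R k) sequentially"
          using R by (simp add: filterlim_at_top_dense)
        then show "eventually (\<lambda>k. x \<in> F \<inter> ball x0 (R k)) sequentially"
          using \<open>x \<in> F\<close> by (auto elim: eventually_mono)
      qed (use t g Z real in \<open>auto intro!: T_measurable trunc_in_D\<close>)
      then show ?thesis using Z real by (simp add: ennreal_mult)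
    qed
  qed
  have pos: "0 < A * K" "0 < c / 4" using A Kc by auto
  show ?thesis
    unfolding full_off_diagonal_def
    by (rule exI[of _ "A * K"], rule conjI[OF pos(1)], rule exI[of _ "c / 4"], rule conjI[OF pos(2)])
       (intro allI impI ballI main)
qed

end

section \<open>The equivalence, including the null measure\<close>

theorem proposition3p3:
  fixes M :: "'a::metric_space measure"
    and \<phi> :: "real \<Rightarrow> real"
    and p q :: ennreal
    and D :: "('a \<Rightarrow> 'k::{real_normed_field, second_countable_topology}) set"
    and T :: "real \<Rightarrow> ('a \<Rightarrow> 'k) \<Rightarrow> 'a \<Rightarrow> 'k"
  assumes "mono_on {0<..} \<phi>"
    and "doubling_measure M"
    and "phi_growth M \<phi>"
    and "1 \<le> p" and "p < q"
    and "truncation_stable_space M D"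
    and "sublinear_family M D T"
    and "controlled_by_truncations M p D T"
  shows "off_diagonal_on_balls M p q D T \<longleftrightarrow> full_off_diagonal M \<phi> p q D T"
proof -
  obtain C0 where sets: "sets M = sets borel"
    and C0: "\<And>x r. r > 0 \<Longrightarrow> emeasure M (ball x (2 * r)) \<le> ennreal C0 * emeasure M (ball x r)"
    and fin: "\<And>x r. r > 0 \<Longrightarrow> emeasure M (ball x r) < \<infinity>"
    using assms(2) unfolding doubling_measure_def by auto
  obtain c1 c2 where c: "0 < c1" "0 < c2"
    and growth: "\<And>x r. r > 0 \<Longrightarrow> c1 * \<phi> r \<le> measure M (ball x r)"
      "\<And>x r. r > 0 \<Longrightarrow> measure M (ball x r) \<le> c2 * \<phi> r"
    using assms(3) unfolding phi_growth_def by auto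
  have emeasure_ball: "emeasure M (ball x r) = ennreal (measure M (ball x r))" if "r > 0" for x r
    using fin[OF that, of x] by (intro emeasure_eq_ennreal_measure) auto
  have \<phi>_nonneg: "0 \<le> \<phi> r" if "r > 0" for r
  proof -
    have "0 \<le> c2 * \<phi> r" using growth(2)[OF that] measure_nonneg order_trans by blast
    then show ?thesis using c by (simp add: zero_le_mult_iff)
  qed
  show ?thesis
  \<comment> \<open>Either \<open>\<phi>\<close> is positive throughout, as the locale requires, or
    it vanishes at one radius, which forces all balls of that radius to be null.\<close>
  proof (cases "\<exists>r>0. \<phi> r = 0")
    case False
    \<comment> \<open>The maximum with \<open>2\<close> keeps \<open>\<kappa>\<close> positive while
      \<open>2 powr \<kappa> \<ge> C0\<close>.\<close>
    define \<kappa> where "\<kappa> = log 2 (max C0 2)"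
    have \<kappa>: "2 powr \<kappa> = max C0 2" by (simp add: \<kappa>_def)
    interpret operator_family M \<phi> \<kappa> c1 c2 p q D T
    proof
      show "emeasure M (ball x r) < \<infinity>" for x r
        using fin[of r x] by (cases "r > 0") (auto simp: ball_empty)
      show "measure M (ball x (2 * r)) \<le> 2 powr \<kappa> * measure M (ball x r)" if "r > 0" for x r
      proof -
        have "ennreal (measure M (ball x (2 * r))) \<le> ennreal C0 * ennreal (measure M (ball x r))"
          using C0[OF that, of x] that by (simp add: emeasure_ball)
        also have "\<dots> \<le> ennreal (2 powr \<kappa>) * ennreal (measure M (ball x r))"
          unfolding \<kappa> by (intro mult_right_mono ennreal_leI) auto
        finally show ?thesis by (simp flip: ennreal_mult)
      qed
      have "0 < log 2 (2::real)" by simp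
      also have "\<dots> \<le> \<kappa>" unfolding \<kappa>_def by (subst log_le_cancel_iff) auto
      finally show "0 < \<kappa>" .
      show "0 < \<phi> r" if "r > 0" for r
        using False \<phi>_nonneg[OF that] that by (auto simp: less_le)
    qed (use sets c growth assms in auto)
    show ?thesis using full_imp_balls balls_imp_full assms(8) by blast
  next
    case True
    \<comment> \<open>\<open>\<mu> = 0\<close>, and both estimates are trivial.\<close>
    then obtain r0 where r0: "r0 > 0" "\<phi> r0 = 0" by blast
    \<comment> \<open>Doubling spreads the vanishing from radius \<open>r0\<close> to all radii
      \<open>2 ^ n * r0\<close>, and these balls exhaust the space.\<close>
    have zero: "emeasure M (ball x (2 ^ n * r0)) = 0" for x n
    proof (induction n)
      case 0
      have "measure M (ball x r0) = 0"
        using growth(2)[OF r0(1), of x] r0(2) by (simp add: measure_le_0_iff)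
      then show ?case using r0 by (simp add: emeasure_ball)
    next
      case (Suc n)
      then show ?case using C0[of "2 ^ n * r0" x] r0(1) by (simp add: mult.assoc)
    qed
    have "emeasure M (space M) = 0"
    proof -
      obtain x0 :: 'a where True by blast
      have "space M = (\<Union>n. ball x0 (2 ^ n * r0))"
      proof -
        have "\<exists>n. dist x0 x < 2 ^ n * r0" for x
        proof -
          obtain n :: nat where "dist x0 x / r0 < 2 ^ n" using real_arch_pow[of 2] by auto
          then show ?thesis using r0(1) by (auto simp: field_simps)
        qed
        then show ?thesis using sets_eq_imp_space_eq[OF sets] by auto
      qed
      then show ?thesis using zero sets
        by (auto intro!: emeasure_UN_eq_0)
    qed
    note null = Lnorm_null_measure[OF this]
    have meas: "T t (trunc A f) \<in> borel_measurable M" if "0 < t" "f \<in> D" "A \<in> sets M" for t A f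
      using assms(6,7) that by (auto simp: truncation_stable_space_def sublinear_family_def)
    have annulus: "annulus x r j \<in> sets borel" for x :: 'a and r j
      by (simp add: annulus_def)
    \<comment> \<open>Every left-hand side is \<open>0\<close>, so the value \<open>1\<close> serves
      for all the constants, here and in the full estimates.\<close>
    have "off_diagonal_on_balls M p q D T"
      unfolding off_diagonal_on_balls_def
      by (intro exI[of _ "1::real"] conjI allI impI ballI) (auto simp: null meas annulus sets)
    moreover have "full_off_diagonal M \<phi> p q D T"
      unfolding full_off_diagonal_def
      by (intro exI[of _ "1::real"] conjI allI impI ballI) (auto simp: null meas sets)
    ultimately show ?thesis by blast
  qed
qed

end
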